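(* Let $G$ be a unique product monoid and $S=R*G$ a crossed product. Let $M$ be a right $R$-module, with induced right $S$-module $M*G=M\otimes_R S$. (1) $\operatorname{Ass}(M*G)=\{\,(\sigma(g)^{-1}(J):G)*G \mid g\in G \text{ and } J \text{ is the annihilator of an } S\text{-prime submodule of } M_{\sigma(g)}\,\}$. (2) If $\sigma$ is pointwise surjective and $(G,\sigma)$ is reversible up to conjugation, then $\operatorname{Ass}(M*G)=\{\,(J:G)*G\mid J\text{ is the annihilator of an } S\text{-prime submodule of } M\,\}$. (3) If $R$ satisfies the ascending chain condition on (two-sided) ideals and $\sigma$ is pointwise surjective, then $\operatorname{Ass}(M*G)=\{\,(P:G)*G\mid P\in\operatorname{Ass} M\,\}$.
   Context: Rings have $1$, modules are unital right modules, ideals are two-sided. A unique product monoid is a monoid $G$ (identity $e$) such that whenever $X,Y$ are nonempty finite subsets of $G$, there exist $x\in X$, $y\in Y$ with $xy\ne x'y'$ for every pair $(x',y')\in X\times Y$ different from $(x,y)$. A crossed product $S=R*G$ is determined by a ring $R$, a monoid $G$, and functions $\sigma:G\to\operatorname{End}_{\mathrm{Ring}}(R)$ and $c:G\times G\to GL_1(R)$ (units of $R$); write $r^g=\sigma(g)(r)$. $S=\bigoplus_{g\in G}R\overline{g}$ is a free left $R$-module with basis $\{\overline g:g\in G\}$ and multiplication determined by $\overline g\, r=r^g\,\overline g$ and $\overline g\,\overline h=c(g,h)\overline{gh}$, where for all $r\in R$, $g,h,i\in G$: $r^e=r$; $c(g,e)=c(e,g)=1$; $(r^h)^g c(g,h)=c(g,h)r^{gh}$;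 $c(g,h)c(gh,i)=c(h,i)^g c(g,hi)$. $R$ is identified with $R\overline e$. $M\otimes_R S$ is identified with $M*G=\bigoplus_{g\in G}M\overline g$, with $m\overline g\cdot r\overline h=m r^g c(g,h)\overline{gh}$; for an ideal $I$ of $R$, $I*G=IS=\bigoplus_g I\overline g$. For a ring endomorphism $\phi$ of $R$, the twist $M_\phi$ is the $R$-module with the same additive group as $M$ and action $m*r=m\phi(r)$; submodules of $M_\phi$ are $R$-submodules for this action and their annihilators are taken in $R$ for this action. $(X:G)=\{r\in R: r^g\in X\text{ for all }g\in G\}$ for $X\subseteq R$. $\sigma$ is pointwise surjective if $\sigma(g)$ is surjective for all $g\in G$. For $g,h\in G$ write $g\equiv h$ if $\sigma(g)=\tau\circ\sigma(h)$ for some inner automorphism $\tau$ of $R$; $(G,\sigma)$ is reversible up to conjugation if for any $g,h\in G$ there exist $h_1,h_2\in G$ with $gh\equiv h_1g$ and $hg\equiv gh_2$. A nonzero module is prime if all its nonzero submodules have the same annihilator as the module itself. $\operatorname{Ass}$ of a module is the set of annihilators of its prime submodules. A right $R$-module $L$ is $S$-prime if the right $S$-module $L\otimes_R S$ is prime. *)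

theory Defs
  imports "HOL-Algebra.Ideal"
begin

text \<open>
  HOL-Algebra only has left modules over commutative rings. As in its record for modules,
  the fields \<open>mult\<close> and \<open>one\<close> inherited from \<open>ring\<close> are not used.
\<close>

record ('a, 'b) right_module = "'b ring" +
  ract :: "['b, 'a] \<Rightarrow> 'b" (infixl "\<triangleleft>\<index>" 70)

locale right_module = R?: ring R + M?: abelian_group M for R (structure) and M (structure) +
  assumes ract_closed: "\<lbrakk>x \<in> carrier M; r \<in> carrier R\<rbrakk> \<Longrightarrow> x \<triangleleft>\<^bsub>M\<^esub> r \<in> carrier M"
    and ract_add_left: "\<lbrakk>x \<in> carrier M; y \<in> carrier M; r \<in> carrier R\<rbrakk>
      \<Longrightarrow> (x \<oplus>\<^bsub>M\<^esub> y) \<triangleleft>\<^bsub>M\<^esub> r = (x \<triangleleft>\<^bsub>M\<^esub> r) \<oplus>\<^bsub>M\<^esub> (y \<triangleleft>\<^bsub>M\<^esub> r)"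
    and ract_add_right: "\<lbrakk>x \<in> carrier M; r \<in> carrier R; s \<in> carrier R\<rbrakk>
      \<Longrightarrow> x \<triangleleft>\<^bsub>M\<^esub> (r \<oplus>\<^bsub>R\<^esub> s) = (x \<triangleleft>\<^bsub>M\<^esub> r) \<oplus>\<^bsub>M\<^esub> (x \<triangleleft>\<^bsub>M\<^esub> s)"
    and ract_assoc: "\<lbrakk>x \<in> carrier M; r \<in> carrier R; s \<in> carrier R\<rbrakk>
      \<Longrightarrow> (x \<triangleleft>\<^bsub>M\<^esub> r) \<triangleleft>\<^bsub>M\<^esub> s = x \<triangleleft>\<^bsub>M\<^esub> (r \<otimes>\<^bsub>R\<^esub> s)"
    and ract_one: "x \<in> carrier M \<Longrightarrow> x \<triangleleft>\<^bsub>M\<^esub> \<one>\<^bsub>R\<^esub> = x"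

definition right_submodule ::
    "'b set \<Rightarrow> ('a, 'r) ring_scheme \<Rightarrow> ('a, 'b, 'm) right_module_scheme \<Rightarrow> bool" where
  "right_submodule N R M \<longleftrightarrow>
     subgroup N (add_monoid M) \<and> (\<forall>x\<in>N. \<forall>r\<in>carrier R. x \<triangleleft>\<^bsub>M\<^esub> r \<in> N)"

definition ann :: "('a, 'r) ring_scheme \<Rightarrow> ('a, 'b, 'm) right_module_scheme \<Rightarrow> 'a set" where
  "ann R M = {r \<in> carrier R. \<forall>x\<in>carrier M. x \<triangleleft>\<^bsub>M\<^esub> r = \<zero>\<^bsub>M\<^esub>}"

definition prime_module ::
    "('a, 'r) ring_scheme \<Rightarrow> ('a, 'b, 'm) right_module_scheme \<Rightarrow> bool" where
  "prime_module R M \<longleftrightarrow> carrier M \<noteq> {\<zero>\<^bsub>M\<^esub>} \<and>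
     (\<forall>N. right_submodule N R M \<and> N \<noteq> {\<zero>\<^bsub>M\<^esub>} \<longrightarrow> ann R (M\<lparr>carrier := N\<rparr>) = ann R M)"

definition Ass :: "('a, 'r) ring_scheme \<Rightarrow> ('a, 'b, 'm) right_module_scheme \<Rightarrow> 'a set set" where
  "Ass R M = {ann R (M\<lparr>carrier := N\<rparr>) | N.
     right_submodule N R M \<and> prime_module R (M\<lparr>carrier := N\<rparr>)}"

definition twist ::
    "('a, 'b, 'm) right_module_scheme \<Rightarrow> ('a \<Rightarrow> 'a) \<Rightarrow> ('a, 'b, 'm) right_module_scheme" where
  "twist M \<phi> = M\<lparr>ract := \<lambda>x r. x \<triangleleft>\<^bsub>M\<^esub> \<phi> r\<rparr>"

definition acc_ideals :: "('a, 'r) ring_scheme \<Rightarrow> bool" where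
  "acc_ideals R \<longleftrightarrow> (\<forall>I :: nat \<Rightarrow> 'a set.
     (\<forall>n. ideal (I n) R) \<and> (\<forall>n. I n \<subseteq> I (Suc n)) \<longrightarrow> (\<exists>N. \<forall>n\<ge>N. I n = I N))"

locale unique_product_monoid = monoid G for G (structure) +
  assumes unique_product:
    "\<lbrakk>X \<subseteq> carrier G; finite X; X \<noteq> {}; Y \<subseteq> carrier G; finite Y; Y \<noteq> {}\<rbrakk>
     \<Longrightarrow> \<exists>x\<in>X. \<exists>y\<in>Y. \<forall>(x', y') \<in> X \<times> Y. (x', y') \<noteq> (x, y) \<longrightarrow> x \<otimes> y \<noteq> x' \<otimes> y'"

locale crossed_system = R?: ring R + G?: monoid G for R (structure) and G (structure) +
  fixes \<sigma> :: "'g \<Rightarrow> 'a \<Rightarrow> 'a" and c :: "'g \<Rightarrow> 'g \<Rightarrow> 'a"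
  assumes \<sigma>_hom: "g \<in> carrier G \<Longrightarrow> \<sigma> g \<in> ring_hom R R"
    and c_unit: "\<lbrakk>g \<in> carrier G; h \<in> carrier G\<rbrakk> \<Longrightarrow> c g h \<in> Units R"
    and \<sigma>_one: "r \<in> carrier R \<Longrightarrow> \<sigma> \<one>\<^bsub>G\<^esub> r = r"
    and c_one_right: "g \<in> carrier G \<Longrightarrow> c g \<one>\<^bsub>G\<^esub> = \<one>\<^bsub>R\<^esub>"
    and c_one_left: "g \<in> carrier G \<Longrightarrow> c \<one>\<^bsub>G\<^esub> g = \<one>\<^bsub>R\<^esub>"
    and twisted_action: "\<lbrakk>r \<in> carrier R; g \<in> carrier G; h \<in> carrier G\<rbrakk>
      \<Longrightarrow> \<sigma> g (\<sigma> h r) \<otimes>\<^bsub>R\<^esub> c g h = c g h \<otimes>\<^bsub>R\<^esub> \<sigma> (g \<otimes>\<^bsub>G\<^esub> h) r"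
    and cocycle: "\<lbrakk>g \<in> carrier G; h \<in> carrier G; i \<in> carrier G\<rbrakk>
      \<Longrightarrow> c g h \<otimes>\<^bsub>R\<^esub> c (g \<otimes>\<^bsub>G\<^esub> h) i = \<sigma> g (c h i) \<otimes>\<^bsub>R\<^esub> c g (h \<otimes>\<^bsub>G\<^esub> i)"

text \<open>
  A formal sum of terms \<open>a\<^sub>g g\<close> is the function \<open>g \<mapsto> a\<^sub>g\<close>, with finite support
  inside \<open>carrier G\<close>; it is \<open>\<zero>\<close> outside \<open>carrier G\<close> so that equality is function equality.
\<close>

definition supp :: "('b, 'm) ring_scheme \<Rightarrow> ('g \<Rightarrow> 'b) \<Rightarrow> 'g set" where
  "supp A f = {g. f g \<noteq> \<zero>\<^bsub>A\<^esub>}"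

definition formal_sums ::
    "('b, 'm) ring_scheme \<Rightarrow> ('g, 'k) monoid_scheme \<Rightarrow> ('g \<Rightarrow> 'b) set" where
  "formal_sums A G = {f. f \<in> carrier G \<rightarrow> carrier A \<and> supp A f \<subseteq> carrier G \<and> finite (supp A f)}"

text \<open>The biadditive extension of \<open>(r g) (s h) = (r (\<sigma> g s) (c g h)) (g h)\<close>.\<close>

definition crossed_product :: "('a, 'r) ring_scheme \<Rightarrow> ('g, 'k) monoid_scheme \<Rightarrow>
    ('g \<Rightarrow> 'a \<Rightarrow> 'a) \<Rightarrow> ('g \<Rightarrow> 'g \<Rightarrow> 'a) \<Rightarrow> ('g \<Rightarrow> 'a) ring" where
  "crossed_product R G \<sigma> c =
    \<lparr>carrier = formal_sums R G,
     mult = (\<lambda>u v k.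
       finsum R (\<lambda>(g, h). u g \<otimes>\<^bsub>R\<^esub> \<sigma> g (v h) \<otimes>\<^bsub>R\<^esub> c g h)
         {(g, h) \<in> supp R u \<times> supp R v. g \<otimes>\<^bsub>G\<^esub> h = k}),
     one = (\<lambda>g. if g = \<one>\<^bsub>G\<^esub> then \<one>\<^bsub>R\<^esub> else \<zero>\<^bsub>R\<^esub>),
     zero = (\<lambda>g. \<zero>\<^bsub>R\<^esub>),
     add = (\<lambda>u v g. u g \<oplus>\<^bsub>R\<^esub> v g)\<rparr>"

text \<open>
  The induced module \<open>M * G\<close> over the crossed product, i.e. the tensor product of \<open>M\<close> with it:
  the biadditive extension of \<open>(m g) (r h) = (m (\<sigma> g r) (c g h)) (g h)\<close>.
\<close>

definition induced_module :: "('a, 'r) ring_scheme \<Rightarrow> ('g, 'k) monoid_scheme \<Rightarrow>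
    ('g \<Rightarrow> 'a \<Rightarrow> 'a) \<Rightarrow> ('g \<Rightarrow> 'g \<Rightarrow> 'a) \<Rightarrow> ('a, 'b, 'm) right_module_scheme \<Rightarrow>
    ('g \<Rightarrow> 'a, 'g \<Rightarrow> 'b) right_module" where
  "induced_module R G \<sigma> c M =
    \<lparr>carrier = formal_sums M G,
     mult = undefined,
     one = undefined,
     zero = (\<lambda>g. \<zero>\<^bsub>M\<^esub>),
     add = (\<lambda>x y g. x g \<oplus>\<^bsub>M\<^esub> y g),
     ract = (\<lambda>x u k.
       finsum M (\<lambda>(g, h). x g \<triangleleft>\<^bsub>M\<^esub> (\<sigma> g (u h) \<otimes>\<^bsub>R\<^esub> c g h))
         {(g, h) \<in> supp M x \<times> supp R u. g \<otimes>\<^bsub>G\<^esub> h = k})\<rparr>"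

definition S_prime :: "('a, 'r) ring_scheme \<Rightarrow> ('g, 'k) monoid_scheme \<Rightarrow>
    ('g \<Rightarrow> 'a \<Rightarrow> 'a) \<Rightarrow> ('g \<Rightarrow> 'g \<Rightarrow> 'a) \<Rightarrow> ('a, 'b, 'm) right_module_scheme \<Rightarrow> bool" where
  "S_prime R G \<sigma> c L \<longleftrightarrow> prime_module (crossed_product R G \<sigma> c) (induced_module R G \<sigma> c L)"

definition S_prime_annihilators :: "('a, 'r) ring_scheme \<Rightarrow> ('g, 'k) monoid_scheme \<Rightarrow>
    ('g \<Rightarrow> 'a \<Rightarrow> 'a) \<Rightarrow> ('g \<Rightarrow> 'g \<Rightarrow> 'a) \<Rightarrow> ('a, 'b, 'm) right_module_scheme \<Rightarrow> 'a set set" where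
  "S_prime_annihilators R G \<sigma> c M = {ann R (M\<lparr>carrier := L\<rparr>) | L.
     right_submodule L R M \<and> S_prime R G \<sigma> c (M\<lparr>carrier := L\<rparr>)}"

definition ideal_extension ::
    "('a, 'r) ring_scheme \<Rightarrow> ('g, 'k) monoid_scheme \<Rightarrow> 'a set \<Rightarrow> ('g \<Rightarrow> 'a) set" where
  "ideal_extension R G I = {u \<in> formal_sums R G. \<forall>g\<in>carrier G. u g \<in> I}"

definition core :: "('a, 'r) ring_scheme \<Rightarrow> ('g, 'k) monoid_scheme \<Rightarrow>
    ('g \<Rightarrow> 'a \<Rightarrow> 'a) \<Rightarrow> 'a set \<Rightarrow> 'a set" where
  "core R G \<sigma> X = {r \<in> carrier R. \<forall>g\<in>carrier G. \<sigma> g r \<in> X}"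

definition pointwise_surjective ::
    "('a, 'r) ring_scheme \<Rightarrow> ('g, 'k) monoid_scheme \<Rightarrow> ('g \<Rightarrow> 'a \<Rightarrow> 'a) \<Rightarrow> bool" where
  "pointwise_surjective R G \<sigma> \<longleftrightarrow> (\<forall>g\<in>carrier G. \<sigma> g ` carrier R = carrier R)"

definition equiv_up_to_inner ::
    "('a, 'r) ring_scheme \<Rightarrow> ('g \<Rightarrow> 'a \<Rightarrow> 'a) \<Rightarrow> 'g \<Rightarrow> 'g \<Rightarrow> bool" where
  "equiv_up_to_inner R \<sigma> g h \<longleftrightarrow>
     (\<exists>u\<in>Units R. \<forall>r\<in>carrier R. \<sigma> g r = u \<otimes>\<^bsub>R\<^esub> \<sigma> h r \<otimes>\<^bsub>R\<^esub> inv\<^bsub>R\<^esub> u)"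

definition reversible_up_to_conjugation ::
    "('a, 'r) ring_scheme \<Rightarrow> ('g, 'k) monoid_scheme \<Rightarrow> ('g \<Rightarrow> 'a \<Rightarrow> 'a) \<Rightarrow> bool" where
  "reversible_up_to_conjugation R G \<sigma> \<longleftrightarrow> (\<forall>g\<in>carrier G. \<forall>h\<in>carrier G.
     \<exists>h\<^sub>1\<in>carrier G. \<exists>h\<^sub>2\<in>carrier G.
       equiv_up_to_inner R \<sigma> (g \<otimes>\<^bsub>G\<^esub> h) (h\<^sub>1 \<otimes>\<^bsub>G\<^esub> g) \<and>
       equiv_up_to_inner R \<sigma> (h \<otimes>\<^bsub>G\<^esub> g) (g \<otimes>\<^bsub>G\<^esub> h\<^sub>2))"

end

theory Submission
  imports Defs "HOL-Algebra.QuotRing"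
begin

text \<open>In the monoid \<open>G\<close> the basis elements of \<open>S\<close> need not be
  invertible, and \<sigma>(g) need be neither injective nor surjective. A coefficient sitting in
  degree g therefore cannot be moved to the identity degree, and it sees \<open>R\<close> only
  through \<sigma>(g). This is why (1) ranges over submodules of twists of \<open>M\<close>.

  Cores arise from multiplying by monomials: up to a unit, r acts on the coefficient that has moved
  from degree g to degree gh as \<sigma>(g)(\<sigma>(h)(r)) acts on the original one, and h is
  arbitrary. Two-sided ideals do not notice conjugation by units. Hence the cocycle drops out of
  every membership question, and \<sigma> may be treated as if it were multiplicative; for the same
  reason the relation of (2) suffices to exchange \<sigma>(gh) and \<sigma>(h'g).

  Surjectivity turns submodules of twists into submodules of \<open>M\<close>. Whether S-primeness
  survives this change of module is a separate matter; reversibility is what secures it in (2). In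
  (3) the chain condition acts twice: it makes cores insensitive to preimages, and it supplies a
  maximal annihilator, hence a prime submodule, inside each nonzero submodule.\<close>

text \<open>
  Call an element \<open>n\<close> of \<open>M * G\<close> good if for each \<open>r\<close> in \<open>R\<close> the elements \<open>n g \<triangleleft> \<sigma> g r\<close> with
  \<open>g\<close> in the support of \<open>n\<close> vanish either all or not at all. Nonzero elements of minimal support
  in a submodule are good, and by the unique product property a good \<open>n\<close> is annihilated by
  \<open>u\<close> only if each coefficient of \<open>u\<close> annihilates it. Hence for \<open>g\<close> in the support of \<open>n\<close> the submodule
  generated by \<open>n\<close> has annihilator \<open>(I : G) * G\<close>, where \<open>I\<close> is the annihilator of the cyclic
  submodule generated by \<open>n g\<close> in the twist of \<open>M\<close> by \<open>\<sigma> g\<close>. Primeness of submodules of \<open>M * G\<close> and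
  S-primeness of submodules of the twists thus become conditions on the cores of such ideals \<open>I\<close>.
  Under the chain condition every ideal \<open>P\<close> satisfies \<open>(\<sigma>(g)\<^sup>-\<^sup>1(P) : G) = (P : G)\<close>, because the
  increasing chain of preimages of a \<open>\<sigma>(g)\<close>-stable ideal under a surjective \<open>\<sigma>(g)\<close> must be constant.
\<close>

section \<open>Right modules\<close>

lemma right_submodule_subset: "right_submodule N A P \<Longrightarrow> N \<subseteq> carrier P"
  unfolding right_submodule_def using subgroup.subset by fastforce

lemma right_submodule_zero: "right_submodule N A P \<Longrightarrow> \<zero>\<^bsub>P\<^esub> \<in> N"
  unfolding right_submodule_def using subgroup.one_closed by fastforce

lemma right_submodule_add:
  "right_submodule N A P \<Longrightarrow> x \<in> N \<Longrightarrow> y \<in> N \<Longrightarrow> x \<oplus>\<^bsub>P\<^esub> y \<in> N"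
  unfolding right_submodule_def using subgroup.m_closed by fastforce

lemma right_submodule_a_inv:
  "right_submodule N A P \<Longrightarrow> x \<in> N \<Longrightarrow> \<ominus>\<^bsub>P\<^esub> x \<in> N"
  unfolding right_submodule_def a_inv_def using subgroup.m_inv_closed by fastforce

lemma right_submodule_ract:
  "right_submodule N A P \<Longrightarrow> x \<in> N \<Longrightarrow> r \<in> carrier A \<Longrightarrow> x \<triangleleft>\<^bsub>P\<^esub> r \<in> N"
  unfolding right_submodule_def by blast

lemma right_submoduleI:
  assumes "abelian_group P" "N \<subseteq> carrier P" "\<zero>\<^bsub>P\<^esub> \<in> N"
    and "\<And>x y. x \<in> N \<Longrightarrow> y \<in> N \<Longrightarrow> x \<oplus>\<^bsub>P\<^esub> y \<in> N"
    and "\<And>x. x \<in> N \<Longrightarrow> \<ominus>\<^bsub>P\<^esub> x \<in> N"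
    and "\<And>x r. x \<in> N \<Longrightarrow> r \<in> carrier A \<Longrightarrow> x \<triangleleft>\<^bsub>P\<^esub> r \<in> N"
  shows "right_submodule N A P"
proof -
  interpret abelian_group P by fact
  have "subgroup N (add_monoid P)"
    by (rule add.subgroupI) (use assms in \<open>auto simp: a_inv_def\<close>)
  then show ?thesis
    unfolding right_submodule_def using assms(6) by blast
qed

lemma right_submodule_restrict_iff:
  assumes "abelian_group P" "right_submodule N A P"
  shows "right_submodule K A (P\<lparr>carrier := N\<rparr>) \<longleftrightarrow> K \<subseteq> N \<and> right_submodule K A P"
proof -
  interpret abelian_group P by fact
  have eq: "add_monoid (P\<lparr>carrier := N\<rparr>) = (add_monoid P)\<lparr>carrier := N\<rparr>"
    by simp
  have N: "subgroup N (add_monoid P)"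
    using assms(2) unfolding right_submodule_def by blast
  have "subgroup K (add_monoid (P\<lparr>carrier := N\<rparr>)) \<longleftrightarrow> K \<subseteq> N \<and> subgroup K (add_monoid P)"
  proof
    assume K: "subgroup K (add_monoid (P\<lparr>carrier := N\<rparr>))"
    then show "K \<subseteq> N \<and> subgroup K (add_monoid P)"
      using add.incl_subgroup[OF N] subgroup.subset[OF K] unfolding eq by simp
  next
    assume "K \<subseteq> N \<and> subgroup K (add_monoid P)"
    then show "subgroup K (add_monoid (P\<lparr>carrier := N\<rparr>))"
      using add.subgroup_incl[OF _ N] unfolding eq by simp
  qed
  then show ?thesis
    unfolding right_submodule_def by auto
qed

lemma ann_restrict_antimono: "K \<subseteq> N \<Longrightarrow> ann A (P\<lparr>carrier := N\<rparr>) \<subseteq> ann A (P\<lparr>carrier := K\<rparr>)"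
  unfolding ann_def by auto

lemma prime_module_restrict_iff:
  assumes "abelian_group P" "right_submodule N A P"
  shows "prime_module A (P\<lparr>carrier := N\<rparr>) \<longleftrightarrow> N \<noteq> {\<zero>\<^bsub>P\<^esub>} \<and>
    (\<forall>K \<subseteq> N. right_submodule K A P \<and> K \<noteq> {\<zero>\<^bsub>P\<^esub>} \<longrightarrow>
      ann A (P\<lparr>carrier := K\<rparr>) = ann A (P\<lparr>carrier := N\<rparr>))"
  unfolding prime_module_def right_submodule_restrict_iff[OF assms] by auto

context right_module
begin

lemma zero_ract: "r \<in> carrier R \<Longrightarrow> \<zero>\<^bsub>M\<^esub> \<triangleleft>\<^bsub>M\<^esub> r = \<zero>\<^bsub>M\<^esub>"
  using ract_add_left[of "\<zero>\<^bsub>M\<^esub>" "\<zero>\<^bsub>M\<^esub>" r] ract_closed[of "\<zero>\<^bsub>M\<^esub>" r]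
  by (auto dest: sym simp: M.add.l_cancel_one)

lemma ract_zero: "x \<in> carrier M \<Longrightarrow> x \<triangleleft>\<^bsub>M\<^esub> \<zero>\<^bsub>R\<^esub> = \<zero>\<^bsub>M\<^esub>"
  using ract_add_right[of x "\<zero>\<^bsub>R\<^esub>" "\<zero>\<^bsub>R\<^esub>"] ract_closed[of x "\<zero>\<^bsub>R\<^esub>"]
  by (auto dest: sym simp: M.add.l_cancel_one)

lemma ract_a_inv_left:
  assumes "x \<in> carrier M" "r \<in> carrier R"
  shows "(\<ominus>\<^bsub>M\<^esub> x) \<triangleleft>\<^bsub>M\<^esub> r = \<ominus>\<^bsub>M\<^esub> (x \<triangleleft>\<^bsub>M\<^esub> r)"
proof -
  have "(\<ominus>\<^bsub>M\<^esub> x) \<triangleleft>\<^bsub>M\<^esub> r \<oplus>\<^bsub>M\<^esub> x \<triangleleft>\<^bsub>M\<^esub> r = \<zero>\<^bsub>M\<^esub>"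
    using assms by (simp add: ract_add_left[symmetric] M.l_neg zero_ract)
  then show ?thesis
    using assms M.minus_equality[of "(\<ominus>\<^bsub>M\<^esub> x) \<triangleleft>\<^bsub>M\<^esub> r" "x \<triangleleft>\<^bsub>M\<^esub> r"] ract_closed by simp
qed

lemma ract_a_inv_right:
  assumes "x \<in> carrier M" "r \<in> carrier R"
  shows "x \<triangleleft>\<^bsub>M\<^esub> (\<ominus>\<^bsub>R\<^esub> r) = \<ominus>\<^bsub>M\<^esub> (x \<triangleleft>\<^bsub>M\<^esub> r)"
proof -
  have "x \<triangleleft>\<^bsub>M\<^esub> (\<ominus>\<^bsub>R\<^esub> r) \<oplus>\<^bsub>M\<^esub> x \<triangleleft>\<^bsub>M\<^esub> r = \<zero>\<^bsub>M\<^esub>"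
    using assms by (simp add: ract_add_right[symmetric] R.l_neg ract_zero)
  then show ?thesis
    using assms M.minus_equality[of "x \<triangleleft>\<^bsub>M\<^esub> (\<ominus>\<^bsub>R\<^esub> r)" "x \<triangleleft>\<^bsub>M\<^esub> r"] ract_closed by simp
qed

text \<open>The inverse of u undoes its action. This lets trailing factors \<open>c g h\<close> be
  dropped from every vanishing condition.\<close>

lemma ract_Units_eq_zero_iff:
  assumes "x \<in> carrier M" "u \<in> Units R"
  shows "x \<triangleleft>\<^bsub>M\<^esub> u = \<zero>\<^bsub>M\<^esub> \<longleftrightarrow> x = \<zero>\<^bsub>M\<^esub>"
proof
  assume "x \<triangleleft>\<^bsub>M\<^esub> u = \<zero>\<^bsub>M\<^esub>"
  then have "x \<triangleleft>\<^bsub>M\<^esub> u \<triangleleft>\<^bsub>M\<^esub> inv\<^bsub>R\<^esub> u = \<zero>\<^bsub>M\<^esub>"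
    using assms zero_ract R.Units_closed by simp
  then show "x = \<zero>\<^bsub>M\<^esub>"
    using assms by (simp add: ract_assoc ract_one R.Units_closed)
next
  assume "x = \<zero>\<^bsub>M\<^esub>"
  then show "x \<triangleleft>\<^bsub>M\<^esub> u = \<zero>\<^bsub>M\<^esub>"
    using assms zero_ract R.Units_closed by simp
qed

lemma right_module_restrict:
  assumes "right_submodule L R M"
  shows "right_module R (M\<lparr>carrier := L\<rparr>)"
proof -
  have sub: "L \<subseteq> carrier M"
    using right_submodule_subset[OF assms] .
  have "abelian_group (M\<lparr>carrier := L\<rparr>)"
  proof (rule abelian_groupI)
    fix x assume "x \<in> carrier (M\<lparr>carrier := L\<rparr>)"
    then show "\<exists>y\<in>carrier (M\<lparr>carrier := L\<rparr>). y \<oplus>\<^bsub>M\<lparr>carrier := L\<rparr>\<^esub> x = \<zero>\<^bsub>M\<lparr>carrier := L\<rparr>\<^esub>"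
      using sub by (intro bexI[of _ "\<ominus>\<^bsub>M\<^esub> x"]) (auto simp: right_submodule_a_inv[OF assms] M.l_neg)
  qed (auto simp: subsetD[OF sub] M.a_assoc right_submodule_add[OF assms]
    right_submodule_zero[OF assms] intro!: M.a_comm)
  moreover have "right_module_axioms R (M\<lparr>carrier := L\<rparr>)"
    by unfold_locales
      (simp_all add: right_submodule_ract[OF assms] subsetD[OF sub]
        ract_add_left ract_add_right ract_assoc ract_one)
  ultimately show ?thesis
    by (simp add: right_module_def R.ring_axioms)
qed

lemma right_module_twist:
  assumes "\<phi> \<in> ring_hom R R"
  shows "right_module R (twist M \<phi>)"
proof -
  have "abelian_group (twist M \<phi>)"
    by (rule abelian_groupI)
      (auto simp: twist_def M.a_assoc intro: M.a_comm bexI[of _ "\<ominus>\<^bsub>M\<^esub> _"] M.l_neg)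
  moreover have "right_module_axioms R (twist M \<phi>)"
    by unfold_locales
      (use assms in \<open>auto simp: twist_def ring_hom_closed ring_hom_mult ring_hom_add ring_hom_one
        ract_closed ract_add_left ract_add_right ract_assoc ract_one\<close>)
  ultimately show ?thesis
    by (simp add: right_module_def R.ring_axioms)
qed

lemma ideal_ann: "ideal (ann R M) R"
proof (rule idealI)
  show "ring R" by (rule R.ring_axioms)
  show "subgroup (ann R M) (add_monoid R)"
  proof (rule R.add.subgroupI)
    show "ann R M \<noteq> {}"
      using ract_zero by (auto simp: ann_def)
    fix a assume "a \<in> ann R M"
    then show "\<ominus>\<^bsub>R\<^esub> a \<in> ann R M"
      by (simp add: ann_def ract_a_inv_right)
  qed (auto simp: ann_def ract_add_right)
  fix a x assume "a \<in> ann R M" "x \<in> carrier R"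
  then show "x \<otimes>\<^bsub>R\<^esub> a \<in> ann R M" "a \<otimes>\<^bsub>R\<^esub> x \<in> ann R M"
    by (auto simp: ann_def ract_assoc[symmetric] ract_closed zero_ract)
qed

end

lemma twist_simps:
  "carrier (twist M \<phi>) = carrier M" "x \<triangleleft>\<^bsub>twist M \<phi>\<^esub> r = x \<triangleleft>\<^bsub>M\<^esub> \<phi> r"
  "\<zero>\<^bsub>twist M \<phi>\<^esub> = \<zero>\<^bsub>M\<^esub>" "add (twist M \<phi>) = add M"
  by (simp_all add: twist_def)

text \<open>If y and z were distinct, the sets {x} and {y, z} would have no unique product.\<close>

lemma (in unique_product_monoid) left_cancel:
  assumes "x \<in> carrier G" "y \<in> carrier G" "z \<in> carrier G" "x \<otimes> y = x \<otimes> z"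
  shows "y = z"
proof (rule ccontr)
  assume "y \<noteq> z"
  with unique_product[of "{x}" "{y, z}"] assms show False
    by auto
qed

lemma (in unique_product_monoid) right_cancel:
  assumes "x \<in> carrier G" "y \<in> carrier G" "z \<in> carrier G" "y \<otimes> x = z \<otimes> x"
  shows "y = z"
proof (rule ccontr)
  assume "y \<noteq> z"
  with unique_product[of "{y, z}" "{x}"] assms show False
    by auto
qed

section \<open>Submodules of induced modules\<close>

text \<open>The quantifier over s makes this the annihilator of a submodule, hence two-sided, rather
  than of the single element m. The formula does not involve the carrier of \<open>M\<close>, so it
  is unchanged when \<open>M\<close> is restricted to a submodule.\<close>

definition cyclic_ann ::
    "('a, 'r) ring_scheme \<Rightarrow> ('g \<Rightarrow> 'a \<Rightarrow> 'a) \<Rightarrow> ('a, 'b, 'm) right_module_scheme \<Rightarrow> 'b \<Rightarrow> 'g \<Rightarrow> 'a set" where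
  "cyclic_ann R \<sigma> M m g =
    {r \<in> carrier R. \<forall>s\<in>carrier R. m \<triangleleft>\<^bsub>M\<^esub> \<sigma> g s \<triangleleft>\<^bsub>M\<^esub> \<sigma> g r = \<zero>\<^bsub>M\<^esub>}"

locale crossed_up_system = crossed_system R G \<sigma> c + G?: unique_product_monoid G
  for R (structure) and G (structure) and \<sigma> c
begin

section \<open>Ideals of \<open>R\<close> and their cores under the twisted action of
  \<open>G\<close>\<close>

lemma \<sigma>_closed: "g \<in> carrier G \<Longrightarrow> r \<in> carrier R \<Longrightarrow> \<sigma> g r \<in> carrier R"
  using \<sigma>_hom ring_hom_closed by metis

lemma \<sigma>_mult: "g \<in> carrier G \<Longrightarrow> r \<in> carrier R \<Longrightarrow> s \<in> carrier R \<Longrightarrow>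
    \<sigma> g (r \<otimes>\<^bsub>R\<^esub> s) = \<sigma> g r \<otimes>\<^bsub>R\<^esub> \<sigma> g s"
  using \<sigma>_hom ring_hom_mult by metis

lemma \<sigma>_ring_one: "g \<in> carrier G \<Longrightarrow> \<sigma> g \<one>\<^bsub>R\<^esub> = \<one>\<^bsub>R\<^esub>"
  using \<sigma>_hom ring_hom_one by metis

lemma \<sigma>_zero: "g \<in> carrier G \<Longrightarrow> \<sigma> g \<zero>\<^bsub>R\<^esub> = \<zero>\<^bsub>R\<^esub>"
  using \<sigma>_hom ring_hom_zero R.ring_axioms by metis

lemma c_closed: "g \<in> carrier G \<Longrightarrow> h \<in> carrier G \<Longrightarrow> c g h \<in> carrier R"
  using c_unit R.Units_closed by blast

lemmas closed = \<sigma>_closed c_closed G.m_closed R.m_closed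

lemma ideal_zero: "ideal I R \<Longrightarrow> \<zero>\<^bsub>R\<^esub> \<in> I"
  by (simp add: additive_subgroup.zero_closed ideal.axioms(1))

text \<open>The equation says that r and s are conjugate by u. It covers both the cocycle values and
  the inner automorphisms in \<open>equiv_up_to_inner\<close>.\<close>

lemma ideal_conj_mem_iff:
  assumes "ideal I R" "r \<in> carrier R" "s \<in> carrier R" "u \<in> Units R" "r \<otimes>\<^bsub>R\<^esub> u = u \<otimes>\<^bsub>R\<^esub> s"
  shows "r \<in> I \<longleftrightarrow> s \<in> I"
proof -
  note u = R.Units_closed[OF assms(4)] R.Units_inv_closed[OF assms(4)]
  have "r = u \<otimes>\<^bsub>R\<^esub> s \<otimes>\<^bsub>R\<^esub> inv\<^bsub>R\<^esub> u"
    using assms u by (simp add: assms(5)[symmetric] R.m_assoc)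
  moreover have "s = inv\<^bsub>R\<^esub> u \<otimes>\<^bsub>R\<^esub> r \<otimes>\<^bsub>R\<^esub> u"
    using assms u by (simp add: R.m_assoc) (simp add: R.m_assoc[symmetric])
  ultimately show ?thesis
    using ideal.I_l_closed[OF assms(1)] ideal.I_r_closed[OF assms(1)] u assms by metis
qed

text \<open>By \<open>twisted_action\<close> the two elements are conjugate by \<open>c g h\<close>.
  As far as ideals can tell, \<sigma> is a monoid action.\<close>

lemma \<sigma>_comp_mem_iff:
  assumes "ideal I R" "g \<in> carrier G" "h \<in> carrier G" "r \<in> carrier R"
  shows "\<sigma> g (\<sigma> h r) \<in> I \<longleftrightarrow> \<sigma> (g \<otimes>\<^bsub>G\<^esub> h) r \<in> I"
  by (rule ideal_conj_mem_iff[OF assms(1) _ _ c_unit twisted_action]) (use assms in \<open>auto simp: closed\<close>)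

lemma core_subset: "core R G \<sigma> I \<subseteq> carrier R"
  unfolding core_def by blast

lemma core_mono: "I \<subseteq> J \<Longrightarrow> core R G \<sigma> I \<subseteq> core R G \<sigma> J"
  unfolding core_def by blast

lemma core_le: "core R G \<sigma> I \<subseteq> I"
  unfolding core_def using \<sigma>_one G.one_closed by fastforce

lemma \<sigma>_core:
  assumes "ideal I R" "g \<in> carrier G" "r \<in> core R G \<sigma> I"
  shows "\<sigma> g r \<in> core R G \<sigma> I"
  using assms unfolding core_def by (auto simp: closed \<sigma>_comp_mem_iff)

lemma ideal_vimage:
  assumes "ideal I R" "\<phi> \<in> ring_hom R R"
  shows "ideal {r \<in> carrier R. \<phi> r \<in> I} R"
proof -
  interpret h: ring_hom_ring R R \<phi>
    by (rule ring_hom_ringI2) (use assms R.ring_axioms in auto)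
  show ?thesis
    using h.ideal_vimage[OF assms(1)] by simp
qed

lemma ideal_core:
  assumes "ideal I R"
  shows "ideal (core R G \<sigma> I) R"
proof -
  have "core R G \<sigma> I = \<Inter> ((\<lambda>g. {r \<in> carrier R. \<sigma> g r \<in> I}) ` carrier G)"
    unfolding core_def using G.one_closed by blast
  then show ?thesis
    using R.i_Intersect[of "(\<lambda>g. {r \<in> carrier R. \<sigma> g r \<in> I}) ` carrier G"]
      ideal_vimage[OF assms \<sigma>_hom] G.one_closed by auto
qed

text \<open>An ideal is recovered from its extension by looking at elements concentrated in the
  identity degree. Equality of annihilators in \<open>S\<close> can thereby be tested in
  \<open>R\<close>.\<close>

lemma ideal_extension_inject:
  assumes "ideal I R" "ideal J R"
  shows "ideal_extension R G I = ideal_extension R G J \<longleftrightarrow> I = J"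
proof -
  have sub: "I \<subseteq> J" if I: "ideal I R" and le: "ideal_extension R G I \<subseteq> ideal_extension R G J"
    for I J
  proof
    fix r assume r: "r \<in> I"
    let ?u = "\<lambda>k. if k = \<one>\<^bsub>G\<^esub> then r else \<zero>\<^bsub>R\<^esub>"
    have "?u \<in> ideal_extension R G I"
      using r ideal_zero[OF I] ideal.Icarr[OF I r]
      by (auto simp: ideal_extension_def formal_sums_def supp_def intro: finite_subset[of _ "{\<one>\<^bsub>G\<^esub>}"])
    then have "?u \<in> ideal_extension R G J"
      using le by blast
    then have "?u \<one>\<^bsub>G\<^esub> \<in> J"
      using G.one_closed unfolding ideal_extension_def by blast
    then show "r \<in> J"
      by simp
  qed
  show ?thesis
    using sub[OF assms(1), of J] sub[OF assms(2), of I] by blast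
qed

end

locale crossed_module = crossed_up_system R G \<sigma> c + right_module R M
  for R (structure) and G (structure) and \<sigma> c and M (structure)
begin

abbreviation S where "S \<equiv> crossed_product R G \<sigma> c"

abbreviation MG where "MG \<equiv> induced_module R G \<sigma> c M"

abbreviation single where "single r h \<equiv> (\<lambda>k. if k = h then r else \<zero>\<^bsub>R\<^esub>)"

definition good :: "_ \<Rightarrow> bool" where
  "good n \<longleftrightarrow> (\<forall>r\<in>carrier R. \<forall>g\<in>supp M n. \<forall>g'\<in>supp M n.
     n g \<triangleleft>\<^bsub>M\<^esub> \<sigma> g r = \<zero>\<^bsub>M\<^esub> \<longrightarrow> n g' \<triangleleft>\<^bsub>M\<^esub> \<sigma> g' r = \<zero>\<^bsub>M\<^esub>)"

section \<open>Coefficients of elements of the induced module\<close>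

lemma zero_MG: "\<zero>\<^bsub>MG\<^esub> = (\<lambda>g. \<zero>\<^bsub>M\<^esub>)"
  by (simp add: induced_module_def)

lemma add_MG: "x \<oplus>\<^bsub>MG\<^esub> y = (\<lambda>g. x g \<oplus>\<^bsub>M\<^esub> y g)"
  by (simp add: induced_module_def)

lemma carrier_MG: "carrier MG = formal_sums M G"
  by (simp add: induced_module_def)

lemma carrier_S: "carrier S = formal_sums R G"
  by (simp add: crossed_product_def)

text \<open>The index g is arbitrary: outside \<open>carrier G\<close> the value is zero because the
  support lies inside \<open>carrier G\<close>.\<close>

lemma MG_closed: "x \<in> carrier MG \<Longrightarrow> x g \<in> carrier M"
  by (cases "g \<in> carrier G") (auto simp: carrier_MG formal_sums_def supp_def subset_iff Pi_iff dest: spec[of _ g])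

lemma S_closed: "u \<in> carrier S \<Longrightarrow> u g \<in> carrier R"
  by (cases "g \<in> carrier G") (auto simp: carrier_S formal_sums_def supp_def subset_iff Pi_iff dest: spec[of _ g])

lemma supp_MG: "x \<in> carrier MG \<Longrightarrow> supp M x \<subseteq> carrier G"
  by (auto simp: carrier_MG formal_sums_def)

lemma supp_S: "u \<in> carrier S \<Longrightarrow> supp R u \<subseteq> carrier G"
  by (auto simp: carrier_S formal_sums_def)

lemma finite_supp_MG: "x \<in> carrier MG \<Longrightarrow> finite (supp M x)"
  by (auto simp: carrier_MG formal_sums_def)

lemma finite_supp_S: "u \<in> carrier S \<Longrightarrow> finite (supp R u)"
  by (auto simp: carrier_S formal_sums_def)

lemma supp_empty_iff: "supp M x = {} \<longleftrightarrow> x = \<zero>\<^bsub>MG\<^esub>"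
  by (auto simp: supp_def zero_MG)

lemma single_S: "r \<in> carrier R \<Longrightarrow> h \<in> carrier G \<Longrightarrow> single r h \<in> carrier S"
  by (auto simp: carrier_S formal_sums_def supp_def intro: finite_subset[of _ "{h}"])

lemma abelian_group_MG: "abelian_group MG"
proof (rule abelian_groupI)
  fix x y assume xy: "x \<in> carrier MG" "y \<in> carrier MG"
  have "supp M (\<lambda>g. x g \<oplus>\<^bsub>M\<^esub> y g) \<subseteq> supp M x \<union> supp M y"
    by (auto simp: supp_def)
  then show "x \<oplus>\<^bsub>MG\<^esub> y \<in> carrier MG"
    using xy finite_subset[of "supp M (\<lambda>g. x g \<oplus>\<^bsub>M\<^esub> y g)" "supp M x \<union> supp M y"]
    unfolding carrier_MG add_MG formal_sums_def by blast
next
  show "\<zero>\<^bsub>MG\<^esub> \<in> carrier MG"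
    by (simp add: carrier_MG zero_MG formal_sums_def supp_def)
next
  fix x assume x: "x \<in> carrier MG"
  have eq: "supp M (\<lambda>g. \<ominus>\<^bsub>M\<^esub> x g) = supp M x"
    using MG_closed[OF x] by (auto simp: supp_def M.add.inv_eq_1_iff)
  show "\<exists>y\<in>carrier MG. y \<oplus>\<^bsub>MG\<^esub> x = \<zero>\<^bsub>MG\<^esub>"
    by (intro bexI[of _ "\<lambda>g. \<ominus>\<^bsub>M\<^esub> x g"])
      (use x MG_closed[OF x] in \<open>auto simp: add_MG zero_MG M.l_neg carrier_MG formal_sums_def eq\<close>)
qed (auto simp: add_MG zero_MG MG_closed M.a_assoc intro!: M.a_comm)

lemma a_inv_MG:
  assumes "x \<in> carrier MG"
  shows "\<ominus>\<^bsub>MG\<^esub> x = (\<lambda>g. \<ominus>\<^bsub>M\<^esub> x g)"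
proof
  fix g
  interpret MG: abelian_group MG by (rule abelian_group_MG)
  have "(\<ominus>\<^bsub>MG\<^esub> x) g \<oplus>\<^bsub>M\<^esub> x g = \<zero>\<^bsub>M\<^esub>"
    using MG.l_neg[OF assms] unfolding add_MG zero_MG by metis
  then show "(\<ominus>\<^bsub>MG\<^esub> x) g = \<ominus>\<^bsub>M\<^esub> x g"
    using M.minus_equality MG_closed assms MG.a_inv_closed by metis
qed

definition coeff where
  "coeff x u p = x (fst p) \<triangleleft>\<^bsub>M\<^esub> (\<sigma> (fst p) (u (snd p)) \<otimes>\<^bsub>R\<^esub> c (fst p) (snd p))"

lemma ract_MG: "(x \<triangleleft>\<^bsub>MG\<^esub> u) k =
    finsum M (coeff x u) {p \<in> supp M x \<times> supp R u. fst p \<otimes>\<^bsub>G\<^esub> snd p = k}"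
proof -
  have "{(g, h) \<in> supp M x \<times> supp R u. g \<otimes>\<^bsub>G\<^esub> h = k} = {p \<in> supp M x \<times> supp R u. fst p \<otimes>\<^bsub>G\<^esub> snd p = k}"
    by auto
  moreover have "(\<lambda>(g, h). x g \<triangleleft>\<^bsub>M\<^esub> (\<sigma> g (u h) \<otimes>\<^bsub>R\<^esub> c g h)) = coeff x u"
    by (auto simp: coeff_def)
  ultimately show ?thesis
    by (simp add: induced_module_def)
qed

lemma coeff_eq:
  assumes "x \<in> carrier MG" "u \<in> carrier S" "g \<in> carrier G" "h \<in> carrier G"
  shows "coeff x u (g, h) = x g \<triangleleft>\<^bsub>M\<^esub> \<sigma> g (u h) \<triangleleft>\<^bsub>M\<^esub> c g h"
  using assms by (simp add: coeff_def ract_assoc MG_closed S_closed closed)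

lemma coeff_closed:
  assumes "x \<in> carrier MG" "u \<in> carrier S" "g \<in> carrier G" "h \<in> carrier G"
  shows "coeff x u (g, h) \<in> carrier M"
  using assms by (simp add: coeff_def MG_closed S_closed closed ract_closed)

lemma coeff_eq_zero_iff:
  assumes "x \<in> carrier MG" "u \<in> carrier S" "g \<in> carrier G" "h \<in> carrier G"
  shows "coeff x u (g, h) = \<zero>\<^bsub>M\<^esub> \<longleftrightarrow> x g \<triangleleft>\<^bsub>M\<^esub> \<sigma> g (u h) = \<zero>\<^bsub>M\<^esub>"
  using assms by (simp add: coeff_eq ract_Units_eq_zero_iff c_unit MG_closed S_closed closed ract_closed)

lemma coeff_outside:
  assumes "x \<in> carrier MG" "u \<in> carrier S" "g \<in> carrier G" "h \<in> carrier G"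
    and "g \<notin> supp M x \<or> h \<notin> supp R u"
  shows "coeff x u (g, h) = \<zero>\<^bsub>M\<^esub>"
  using assms coeff_eq_zero_iff[OF assms(1-4)]
  by (auto simp: supp_def zero_ract ract_zero \<sigma>_zero S_closed MG_closed closed)

text \<open>A coefficient of a product is a finite sum of terms, so any additively closed set with
  zero that contains the terms contains it. The set \<open>B\<close> is later taken to be {0}, the
  whole module, the elements killed by a fixed ring element, and a homogeneous component of a
  submodule.\<close>

lemma ract_MG_mem:
  assumes x: "x \<in> carrier MG" and u: "u \<in> carrier S"
    and "\<zero>\<^bsub>M\<^esub> \<in> B" "\<And>y z. y \<in> B \<Longrightarrow> z \<in> B \<Longrightarrow> y \<oplus>\<^bsub>M\<^esub> z \<in> B" "B \<subseteq> carrier M"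
    and B: "\<And>g h. g \<in> supp M x \<Longrightarrow> h \<in> supp R u \<Longrightarrow> g \<otimes>\<^bsub>G\<^esub> h = k \<Longrightarrow>
      x g \<triangleleft>\<^bsub>M\<^esub> \<sigma> g (u h) \<triangleleft>\<^bsub>M\<^esub> c g h \<in> B"
  shows "(x \<triangleleft>\<^bsub>MG\<^esub> u) k \<in> B"
proof -
  let ?A = "{p \<in> supp M x \<times> supp R u. fst p \<otimes>\<^bsub>G\<^esub> snd p = k}"
  have "finite A \<Longrightarrow> (\<And>p. p \<in> A \<Longrightarrow> coeff x u p \<in> B) \<Longrightarrow> finsum M (coeff x u) A \<in> B" for A
  proof (induction A rule: finite_induct)
    case (insert p A)
    moreover have "coeff x u \<in> A \<rightarrow> carrier M" "coeff x u p \<in> carrier M"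
      using insert.prems assms(5) by blast+
    ultimately show ?case
      using assms(4) by simp
  qed (simp add: assms(3))
  moreover have "finite ?A"
    using finite_supp_MG[OF x] finite_supp_S[OF u] by auto
  moreover have "coeff x u p \<in> B" if "p \<in> ?A" for p
    using that B[of "fst p" "snd p"] coeff_eq[OF x u, of "fst p" "snd p"]
      subsetD[OF supp_MG[OF x], of "fst p"] subsetD[OF supp_S[OF u], of "snd p"]
    by auto
  ultimately show ?thesis
    unfolding ract_MG by blast
qed

lemma ract_MG_eq_zero:
  assumes "x \<in> carrier MG" "u \<in> carrier S"
    and "\<And>g h. g \<in> supp M x \<Longrightarrow> h \<in> supp R u \<Longrightarrow> g \<otimes>\<^bsub>G\<^esub> h = k \<Longrightarrow> x g \<triangleleft>\<^bsub>M\<^esub> \<sigma> g (u h) = \<zero>\<^bsub>M\<^esub>"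
  shows "(x \<triangleleft>\<^bsub>MG\<^esub> u) k = \<zero>\<^bsub>M\<^esub>"
proof -
  have "(x \<triangleleft>\<^bsub>MG\<^esub> u) k \<in> {\<zero>\<^bsub>M\<^esub>}"
    by (rule ract_MG_mem[OF assms(1,2)])
      (use assms supp_MG supp_S in \<open>auto simp: zero_ract c_closed subset_iff\<close>)
  then show ?thesis
    by simp
qed

text \<open>Uniqueness of the factorisation is asked only among pairs whose term does not vanish.
  This weakening is what \<open>good_ract_eq_zero\<close> relies on.\<close>

lemma ract_MG_unique:
  assumes x: "x \<in> carrier MG" and u: "u \<in> carrier S" and g: "g \<in> carrier G" and h: "h \<in> carrier G"
    and uniq: "\<And>g' h'. g' \<in> supp M x \<Longrightarrow> h' \<in> supp R u \<Longrightarrow> g' \<otimes>\<^bsub>G\<^esub> h' = g \<otimes>\<^bsub>G\<^esub> h \<Longrightarrow>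
      (g', h') \<noteq> (g, h) \<Longrightarrow> x g' \<triangleleft>\<^bsub>M\<^esub> \<sigma> g' (u h') = \<zero>\<^bsub>M\<^esub>"
  shows "(x \<triangleleft>\<^bsub>MG\<^esub> u) (g \<otimes>\<^bsub>G\<^esub> h) = x g \<triangleleft>\<^bsub>M\<^esub> \<sigma> g (u h) \<triangleleft>\<^bsub>M\<^esub> c g h"
proof -
  let ?A = "{p \<in> supp M x \<times> supp R u. fst p \<otimes>\<^bsub>G\<^esub> snd p = g \<otimes>\<^bsub>G\<^esub> h} - {(g, h)}"
  have fin: "finite ?A"
    using finite_supp_MG[OF x] finite_supp_S[OF u] by auto
  have zero: "coeff x u p = \<zero>\<^bsub>M\<^esub>" if "p \<in> ?A" for p
  proof -
    obtain g' h' where p: "p = (g', h')"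
      by force
    then have "g' \<in> carrier G" "h' \<in> carrier G"
      using that supp_MG[OF x] supp_S[OF u] by auto
    then show ?thesis
      using that uniq[of g' h'] coeff_eq_zero_iff[OF x u, of g' h'] p by simp
  qed
  have sum: "finsum M (coeff x u) ?A = \<zero>\<^bsub>M\<^esub>"
    using zero by (rule M.add.finprod_one_eqI)
  have Pi: "coeff x u \<in> ?A \<rightarrow> carrier M"
    using zero by simp
  have "(x \<triangleleft>\<^bsub>MG\<^esub> u) (g \<otimes>\<^bsub>G\<^esub> h) = coeff x u (g, h)"
  proof (cases "(g, h) \<in> supp M x \<times> supp R u")
    case True
    then have eq: "{p \<in> supp M x \<times> supp R u. fst p \<otimes>\<^bsub>G\<^esub> snd p = g \<otimes>\<^bsub>G\<^esub> h} = insert (g, h) ?A"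
      by auto
    have "finsum M (coeff x u) (insert (g, h) ?A) = coeff x u (g, h) \<oplus>\<^bsub>M\<^esub> finsum M (coeff x u) ?A"
      by (rule M.finsum_insert[OF fin _ Pi coeff_closed[OF x u g h]]) simp
    then show ?thesis
      unfolding ract_MG eq[symmetric] sum using coeff_closed[OF x u g h] by simp
  next
    \<comment> \<open>The pair (g, h) may lie outside the supports; its own term is then zero and
      the formula still holds.\<close>
    case False
    then have "{p \<in> supp M x \<times> supp R u. fst p \<otimes>\<^bsub>G\<^esub> snd p = g \<otimes>\<^bsub>G\<^esub> h} = ?A"
      by auto
    then show ?thesis
      unfolding ract_MG using sum coeff_outside[OF x u g h] False by auto
  qed
  then show ?thesis
    using coeff_eq[OF x u g h] by simp
qed

lemma ract_MG_closed:
  assumes x: "x \<in> carrier MG" and u: "u \<in> carrier S"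
  shows "x \<triangleleft>\<^bsub>MG\<^esub> u \<in> carrier MG"
proof -
  have sup: "supp M (x \<triangleleft>\<^bsub>MG\<^esub> u) \<subseteq> (\<lambda>p. fst p \<otimes>\<^bsub>G\<^esub> snd p) ` (supp M x \<times> supp R u)"
    unfolding supp_def[of M "x \<triangleleft>\<^bsub>MG\<^esub> u"] using ract_MG_eq_zero[OF x u] by force
  moreover have "finite (supp M x \<times> supp R u)"
    using finite_supp_MG[OF x] finite_supp_S[OF u] by simp
  moreover have "(x \<triangleleft>\<^bsub>MG\<^esub> u) k \<in> carrier M" for k
    by (rule ract_MG_mem[OF x u])
      (use supp_MG[OF x] supp_S[OF u] in \<open>auto simp: ract_closed MG_closed[OF x] S_closed[OF u] closed subset_iff\<close>)
  ultimately show ?thesis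
    using finite_subset[OF sup] supp_MG[OF x] supp_S[OF u]
    unfolding carrier_MG formal_sums_def by (fastforce simp: subset_iff)
qed

text \<open>Right cancellation in \<open>G\<close> leaves only one term in degree gh, so
  multiplication by a monomial never mixes coefficients.\<close>

lemma single_ract:
  assumes "x \<in> carrier MG" "r \<in> carrier R" "g \<in> carrier G" "h \<in> carrier G"
  shows "(x \<triangleleft>\<^bsub>MG\<^esub> single r h) (g \<otimes>\<^bsub>G\<^esub> h) = x g \<triangleleft>\<^bsub>M\<^esub> \<sigma> g r \<triangleleft>\<^bsub>M\<^esub> c g h"
proof -
  have "(x \<triangleleft>\<^bsub>MG\<^esub> single r h) (g \<otimes>\<^bsub>G\<^esub> h) = x g \<triangleleft>\<^bsub>M\<^esub> \<sigma> g (single r h h) \<triangleleft>\<^bsub>M\<^esub> c g h"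
  proof (rule ract_MG_unique)
    fix g' h'
    assume "g' \<in> supp M x" "h' \<in> supp R (single r h)" "g' \<otimes>\<^bsub>G\<^esub> h' = g \<otimes>\<^bsub>G\<^esub> h" "(g', h') \<noteq> (g, h)"
    moreover have "h' = h"
      using \<open>h' \<in> supp R (single r h)\<close> by (auto simp: supp_def split: if_splits)
    ultimately show "x g' \<triangleleft>\<^bsub>M\<^esub> \<sigma> g' (single r h h') = \<zero>\<^bsub>M\<^esub>"
      using right_cancel[of h g' g] assms supp_MG by blast
  qed (use assms single_S in auto)
  then show ?thesis
    by simp
qed

lemma supp_single_ract:
  assumes "x \<in> carrier MG" "r \<in> carrier R" "h \<in> carrier G" "k \<in> supp M (x \<triangleleft>\<^bsub>MG\<^esub> single r h)"
  shows "\<exists>g\<in>supp M x. k = g \<otimes>\<^bsub>G\<^esub> h"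
proof (rule ccontr)
  assume neg: "\<not> ?thesis"
  have "(x \<triangleleft>\<^bsub>MG\<^esub> single r h) k = \<zero>\<^bsub>M\<^esub>"
    by (rule ract_MG_eq_zero) (use assms single_S neg in \<open>auto simp: supp_def split: if_splits\<close>)
  then show False
    using assms by (simp add: supp_def)
qed

text \<open>The unique product property is applied to the support of z and to the set
  \<open>Y\<close> of degrees where u fails to kill z, not to the full support of u. In the degree
  of the unique product all other terms vanish, either by uniqueness or because their degree in u is
  outside \<open>Y\<close>. So one term z x \<sigma> x (u y) is zero, and goodness spreads this over
  the support of z, contradicting the choice of y in \<open>Y\<close>.\<close>

lemma good_ract_eq_zero:
  assumes z: "z \<in> carrier MG" "good z" and u: "u \<in> carrier S" and zu: "z \<triangleleft>\<^bsub>MG\<^esub> u = \<zero>\<^bsub>MG\<^esub>"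
    and g: "g \<in> carrier G"
  shows "z g \<triangleleft>\<^bsub>M\<^esub> \<sigma> g (u k) = \<zero>\<^bsub>M\<^esub>"
proof -
  define Y where "Y = {k \<in> supp R u. \<exists>g\<in>supp M z. z g \<triangleleft>\<^bsub>M\<^esub> \<sigma> g (u k) \<noteq> \<zero>\<^bsub>M\<^esub>}"
  have "Y = {}"
  proof (rule ccontr)
    assume "Y \<noteq> {}"
    have fin: "finite Y"
      unfolding Y_def using finite_supp_S[OF u] by simp
    have "supp M z \<noteq> {}"
      using \<open>Y \<noteq> {}\<close> unfolding Y_def by blast
    then obtain x y where x: "x \<in> supp M z" and y: "y \<in> Y" and
      uniq: "\<forall>(x', y') \<in> supp M z \<times> Y. (x', y') \<noteq> (x, y) \<longrightarrow> x \<otimes>\<^bsub>G\<^esub> y \<noteq> x' \<otimes>\<^bsub>G\<^esub> y'"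
      using unique_product[OF supp_MG[OF z(1)] finite_supp_MG[OF z(1)] _ _ fin \<open>Y \<noteq> {}\<close>]
        supp_S[OF u] unfolding Y_def by blast
    have xG: "x \<in> carrier G" and yG: "y \<in> carrier G"
      using x y supp_MG[OF z(1)] supp_S[OF u] unfolding Y_def by auto
    have "(z \<triangleleft>\<^bsub>MG\<^esub> u) (x \<otimes>\<^bsub>G\<^esub> y) = z x \<triangleleft>\<^bsub>M\<^esub> \<sigma> x (u y) \<triangleleft>\<^bsub>M\<^esub> c x y"
    proof (rule ract_MG_unique[OF z(1) u xG yG])
      fix g' h' assume *: "g' \<in> supp M z" "h' \<in> supp R u" "g' \<otimes>\<^bsub>G\<^esub> h' = x \<otimes>\<^bsub>G\<^esub> y" "(g', h') \<noteq> (x, y)"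
      then have "h' \<notin> Y"
        using uniq by fastforce
      then show "z g' \<triangleleft>\<^bsub>M\<^esub> \<sigma> g' (u h') = \<zero>\<^bsub>M\<^esub>"
        using * unfolding Y_def by blast
    qed
    then have "z x \<triangleleft>\<^bsub>M\<^esub> \<sigma> x (u y) \<triangleleft>\<^bsub>M\<^esub> c x y = \<zero>\<^bsub>M\<^esub>"
      unfolding zu zero_MG by simp
    then have "z x \<triangleleft>\<^bsub>M\<^esub> \<sigma> x (u y) = \<zero>\<^bsub>M\<^esub>"
      using ract_Units_eq_zero_iff[OF _ c_unit[OF xG yG]]
      by (simp add: ract_closed closed MG_closed[OF z(1)] S_closed[OF u] xG)
    then show False
      using y x z(2) S_closed[OF u] unfolding Y_def good_def by blast
  qed
  then show ?thesis
    using g S_closed[OF u]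
    by (cases "g \<in> supp M z"; cases "k \<in> supp R u")
      (auto simp: Y_def supp_def zero_ract ract_zero \<sigma>_zero closed MG_closed[OF z(1)])
qed

text \<open>Elements of minimal support are good, since acting by \<open>r\<close> in \<open>R\<close> never enlarges the support.\<close>

lemma exists_good:
  assumes K: "right_submodule K S MG" and nz: "K \<noteq> {\<zero>\<^bsub>MG\<^esub>}"
  shows "\<exists>n\<in>K. n \<noteq> \<zero>\<^bsub>MG\<^esub> \<and> good n"
proof -
  have sub: "K \<subseteq> carrier MG"
    using right_submodule_subset[OF K] .
  have "\<exists>n. n \<in> K \<and> n \<noteq> \<zero>\<^bsub>MG\<^esub>"
    using right_submodule_zero[OF K] nz by blast
  then obtain n where n: "n \<in> K" "n \<noteq> \<zero>\<^bsub>MG\<^esub>" and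
    min: "\<And>z. z \<in> K \<Longrightarrow> z \<noteq> \<zero>\<^bsub>MG\<^esub> \<Longrightarrow> card (supp M n) \<le> card (supp M z)"
    using ex_has_least_nat[of "\<lambda>n. n \<in> K \<and> n \<noteq> \<zero>\<^bsub>MG\<^esub>" _ "\<lambda>n. card (supp M n)"] by blast
  have nM: "n \<in> carrier MG"
    using n sub by blast
  have "good n"
    unfolding good_def
  proof (intro ballI impI)
    fix r g g' assume r: "r \<in> carrier R" and g: "g \<in> supp M n" and g': "g' \<in> supp M n"
      and zero: "n g \<triangleleft>\<^bsub>M\<^esub> \<sigma> g r = \<zero>\<^bsub>M\<^esub>"
    define z where "z = n \<triangleleft>\<^bsub>MG\<^esub> single r \<one>\<^bsub>G\<^esub>"
    have z: "z \<in> K"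
      unfolding z_def using right_submodule_ract[OF K n(1) single_S[OF r]] G.one_closed by blast
    have coeff: "z k = n k \<triangleleft>\<^bsub>M\<^esub> \<sigma> k r" if "k \<in> carrier G" for k
      using single_ract[OF nM r that G.one_closed] that
      by (simp add: z_def c_one_right ract_one ract_closed MG_closed[OF nM] closed r)
    have gG: "g \<in> carrier G" "g' \<in> carrier G"
      using g g' supp_MG[OF nM] by auto
    have "supp M z \<subseteq> supp M n - {g}"
    proof
      fix k assume k: "k \<in> supp M z"
      then obtain k' where "k' \<in> supp M n" "k = k' \<otimes>\<^bsub>G\<^esub> \<one>\<^bsub>G\<^esub>"
        using supp_single_ract[OF nM r G.one_closed] unfolding z_def by blast
      moreover have "z g = \<zero>\<^bsub>M\<^esub>"
        using coeff zero gG by simp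
      ultimately show "k \<in> supp M n - {g}"
        using k supp_MG[OF nM] by (auto simp: supp_def)
    qed
    then have "card (supp M z) < card (supp M n)"
      using g finite_supp_MG[OF nM] by (intro psubset_card_mono) auto
    then have "z = \<zero>\<^bsub>MG\<^esub>"
      using min[OF z] by fastforce
    then show "n g' \<triangleleft>\<^bsub>M\<^esub> \<sigma> g' r = \<zero>\<^bsub>M\<^esub>"
      using coeff[OF gG(2)] by (simp add: zero_MG)
  qed
  then show ?thesis
    using n by blast
qed

lemma twisted_ract:
  assumes "m \<in> carrier M" "g \<in> carrier G" "h \<in> carrier G" "r \<in> carrier R"
  shows "m \<triangleleft>\<^bsub>M\<^esub> c g h \<triangleleft>\<^bsub>M\<^esub> \<sigma> (g \<otimes>\<^bsub>G\<^esub> h) r = m \<triangleleft>\<^bsub>M\<^esub> \<sigma> g (\<sigma> h r) \<triangleleft>\<^bsub>M\<^esub> c g h"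
  using assms by (simp add: ract_assoc twisted_action closed)

text \<open>This is the dictionary between degrees gh and g: r acting in degree gh on a shifted
  coefficient has the same kernel condition as \<sigma> h r acting in degree g on the original
  one.\<close>

lemma twisted_ract_eq_zero_iff:
  assumes "m \<in> carrier M" "g \<in> carrier G" "h \<in> carrier G" "r \<in> carrier R"
  shows "m \<triangleleft>\<^bsub>M\<^esub> c g h \<triangleleft>\<^bsub>M\<^esub> \<sigma> (g \<otimes>\<^bsub>G\<^esub> h) r = \<zero>\<^bsub>M\<^esub> \<longleftrightarrow> m \<triangleleft>\<^bsub>M\<^esub> \<sigma> g (\<sigma> h r) = \<zero>\<^bsub>M\<^esub>"
  unfolding twisted_ract[OF assms]
  using assms by (simp add: ract_Units_eq_zero_iff c_unit ract_closed closed)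

lemma ract_\<sigma>_mult:
  assumes "m \<in> carrier M" "g \<in> carrier G" "r \<in> carrier R" "s \<in> carrier R"
  shows "m \<triangleleft>\<^bsub>M\<^esub> \<sigma> g r \<triangleleft>\<^bsub>M\<^esub> \<sigma> g s = m \<triangleleft>\<^bsub>M\<^esub> \<sigma> g (r \<otimes>\<^bsub>R\<^esub> s)"
  using assms by (simp add: ract_assoc \<sigma>_mult closed)

text \<open>Up to units, r acts on the coefficient in degree ih as s (\<sigma> h r) acts on n i.
  Goodness of n at this single ring element gives goodness of the product at r.\<close>

lemma good_single_ract:
  assumes n: "n \<in> carrier MG" "good n" and s: "s \<in> carrier R" and h: "h \<in> carrier G"
  shows "good (n \<triangleleft>\<^bsub>MG\<^esub> single s h)"
  unfolding good_def
proof (intro ballI impI)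
  let ?z = "n \<triangleleft>\<^bsub>MG\<^esub> single s h"
  fix r k k' assume r: "r \<in> carrier R" and k: "k \<in> supp M ?z" and k': "k' \<in> supp M ?z"
    and zero: "?z k \<triangleleft>\<^bsub>M\<^esub> \<sigma> k r = \<zero>\<^bsub>M\<^esub>"
  obtain g where g: "g \<in> supp M n" "k = g \<otimes>\<^bsub>G\<^esub> h"
    using supp_single_ract[OF n(1) s h k] by blast
  obtain g' where g': "g' \<in> supp M n" "k' = g' \<otimes>\<^bsub>G\<^esub> h"
    using supp_single_ract[OF n(1) s h k'] by blast
  have gG: "g \<in> carrier G" "g' \<in> carrier G"
    using g g' supp_MG[OF n(1)] by auto
  have *: "?z (i \<otimes>\<^bsub>G\<^esub> h) \<triangleleft>\<^bsub>M\<^esub> \<sigma> (i \<otimes>\<^bsub>G\<^esub> h) r = \<zero>\<^bsub>M\<^esub> \<longleftrightarrow> n i \<triangleleft>\<^bsub>M\<^esub> \<sigma> i (s \<otimes>\<^bsub>R\<^esub> \<sigma> h r) = \<zero>\<^bsub>M\<^esub>"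
    if "i \<in> carrier G" for i
    using that h s r MG_closed[OF n(1)]
    by (simp add: single_ract[OF n(1) s that h] twisted_ract_eq_zero_iff ract_\<sigma>_mult ract_closed closed)
  have "n g \<triangleleft>\<^bsub>M\<^esub> \<sigma> g (s \<otimes>\<^bsub>R\<^esub> \<sigma> h r) = \<zero>\<^bsub>M\<^esub>"
    using zero *[OF gG(1)] unfolding g(2) by blast
  then have "n g' \<triangleleft>\<^bsub>M\<^esub> \<sigma> g' (s \<otimes>\<^bsub>R\<^esub> \<sigma> h r) = \<zero>\<^bsub>M\<^esub>"
    using n(2) g(1) g'(1) R.m_closed[OF s \<sigma>_closed[OF h r]] unfolding good_def by blast
  then show "?z k' \<triangleleft>\<^bsub>M\<^esub> \<sigma> k' r = \<zero>\<^bsub>M\<^esub>"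
    unfolding g'(2) *[OF gG(2)] .
qed

text \<open>The image of \<sigma> g is only a subring in general, so this set is naturally a
  submodule of the twist and not of \<open>M\<close>. The closure conditions are the module laws of
  the twist applied to m.\<close>

lemma right_submodule_cyclic:
  assumes "m \<in> carrier M" "g \<in> carrier G"
  shows "right_submodule ((\<lambda>s. m \<triangleleft>\<^bsub>M\<^esub> \<sigma> g s) ` carrier R) R (twist M (\<sigma> g))"
proof -
  interpret tw: right_module R "twist M (\<sigma> g)"
    by (rule right_module_twist[OF \<sigma>_hom[OF assms(2)]])
  show ?thesis
  proof (rule right_submoduleI)
    show "abelian_group (twist M (\<sigma> g))"
      by (rule tw.abelian_group_axioms)
    show "(\<lambda>s. m \<triangleleft>\<^bsub>M\<^esub> \<sigma> g s) ` carrier R \<subseteq> carrier (twist M (\<sigma> g))"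
      using tw.ract_closed[of m] assms by (auto simp: twist_simps)
    show "\<zero>\<^bsub>twist M (\<sigma> g)\<^esub> \<in> (\<lambda>s. m \<triangleleft>\<^bsub>M\<^esub> \<sigma> g s) ` carrier R"
      using tw.ract_zero[of m] assms by (force simp: twist_simps)
  next
    fix x y
    assume "x \<in> (\<lambda>s. m \<triangleleft>\<^bsub>M\<^esub> \<sigma> g s) ` carrier R" "y \<in> (\<lambda>s. m \<triangleleft>\<^bsub>M\<^esub> \<sigma> g s) ` carrier R"
    then show "x \<oplus>\<^bsub>twist M (\<sigma> g)\<^esub> y \<in> (\<lambda>s. m \<triangleleft>\<^bsub>M\<^esub> \<sigma> g s) ` carrier R"
      using tw.ract_add_right[of m, symmetric] assms by (auto simp: twist_simps)
  next
    fix x assume "x \<in> (\<lambda>s. m \<triangleleft>\<^bsub>M\<^esub> \<sigma> g s) ` carrier R"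
    then show "\<ominus>\<^bsub>twist M (\<sigma> g)\<^esub> x \<in> (\<lambda>s. m \<triangleleft>\<^bsub>M\<^esub> \<sigma> g s) ` carrier R"
      using tw.ract_a_inv_right[of m, symmetric] assms by (auto simp: twist_simps)
  next
    fix x r assume "x \<in> (\<lambda>s. m \<triangleleft>\<^bsub>M\<^esub> \<sigma> g s) ` carrier R" "r \<in> carrier R"
    then show "x \<triangleleft>\<^bsub>twist M (\<sigma> g)\<^esub> r \<in> (\<lambda>s. m \<triangleleft>\<^bsub>M\<^esub> \<sigma> g s) ` carrier R"
      using tw.ract_assoc[of m] assms by (auto simp: twist_simps)
  qed
qed

lemma ann_cyclic:
  "ann R (twist M (\<sigma> g)\<lparr>carrier := (\<lambda>s. m \<triangleleft>\<^bsub>M\<^esub> \<sigma> g s) ` carrier R\<rparr>) = cyclic_ann R \<sigma> M m g"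
  by (auto simp: ann_def cyclic_ann_def twist_simps)

lemma ideal_ann_restrict: "right_submodule L R M \<Longrightarrow> ideal (ann R (M\<lparr>carrier := L\<rparr>)) R"
  by (rule right_module.ideal_ann[OF right_module_restrict])

lemma ideal_cyclic_ann:
  assumes "m \<in> carrier M" "g \<in> carrier G"
  shows "ideal (cyclic_ann R \<sigma> M m g) R"
  by (rule right_module.ideal_ann[OF right_module.right_module_restrict[OF
      right_module_twist[OF \<sigma>_hom[OF assms(2)]] right_submodule_cyclic[OF assms]],
      unfolded ann_cyclic])

lemma cyclic_ann_le:
  assumes "m \<in> carrier M" "g \<in> carrier G" "r \<in> cyclic_ann R \<sigma> M m g"
  shows "m \<triangleleft>\<^bsub>M\<^esub> \<sigma> g r = \<zero>\<^bsub>M\<^esub>"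
proof -
  have "m \<triangleleft>\<^bsub>M\<^esub> \<sigma> g \<one>\<^bsub>R\<^esub> \<triangleleft>\<^bsub>M\<^esub> \<sigma> g r = \<zero>\<^bsub>M\<^esub>"
    using assms unfolding cyclic_ann_def by blast
  then show ?thesis
    using assms by (simp add: \<sigma>_ring_one ract_one)
qed

text \<open>The products of n with monomials already force the annihilator of any submodule
  containing n into \<open>J * G\<close>. It remains to find a submodule of \<open>N\<close>
  containing n that \<open>J * G\<close> does annihilate.\<close>

lemma good_submodule:
  assumes N: "right_submodule N S MG" and n: "n \<in> N" "good n" and g: "g \<in> supp M n"
  shows "\<exists>N'\<subseteq>N. right_submodule N' S MG \<and> n \<in> N' \<and>
    ann S (MG\<lparr>carrier := N'\<rparr>) = ideal_extension R G (core R G \<sigma> (cyclic_ann R \<sigma> M (n g) g))"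
proof -
  let ?I = "cyclic_ann R \<sigma> M (n g) g"
  define J where "J = core R G \<sigma> ?I"
  \<comment> \<open>\<open>N'\<close> is cut out by annihilation instead of being generated by n:
    \<open>J * G\<close> then kills it by construction, and only closure under the action and
    membership of n have to be checked.\<close>
  define N' where "N' = {z \<in> N. \<forall>k\<in>carrier G. \<forall>j\<in>J. z k \<triangleleft>\<^bsub>M\<^esub> \<sigma> k j = \<zero>\<^bsub>M\<^esub>}"
  have sub: "N \<subseteq> carrier MG"
    using right_submodule_subset[OF N] .
  have nM: "n \<in> carrier MG"
    using n sub by blast
  have gG: "g \<in> carrier G"
    using g supp_MG[OF nM] by blast
  have ng: "n g \<in> carrier M"
    using MG_closed[OF nM] .
  have I: "ideal ?I R"
    using ideal_cyclic_ann[OF ng gG] .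
  have J: "ideal J R"
    unfolding J_def using ideal_core[OF I] .
  have Jc: "j \<in> carrier R" if "j \<in> J" for j
    using that core_subset unfolding J_def by blast
  have "right_submodule N' S MG"
  proof (rule right_submoduleI[OF abelian_group_MG])
    show "N' \<subseteq> carrier MG"
      using sub unfolding N'_def by blast
    show "\<zero>\<^bsub>MG\<^esub> \<in> N'"
      using right_submodule_zero[OF N] Jc unfolding N'_def by (simp add: zero_MG zero_ract closed)
  next
    fix x y assume "x \<in> N'" "y \<in> N'"
    then show "x \<oplus>\<^bsub>MG\<^esub> y \<in> N'"
      using right_submodule_add[OF N, of x y] sub Jc unfolding N'_def
      by (auto simp: add_MG ract_add_left MG_closed closed subset_iff)
  next
    fix x assume x: "x \<in> N'"
    then have xM: "x \<in> carrier MG"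
      using sub unfolding N'_def by blast
    show "\<ominus>\<^bsub>MG\<^esub> x \<in> N'"
      using x right_submodule_a_inv[OF N, of x] Jc unfolding N'_def
      by (auto simp: a_inv_MG[OF xM] ract_a_inv_left MG_closed[OF xM] closed)
  next
    fix x u assume x: "x \<in> N'" and u: "u \<in> carrier S"
    then have xM: "x \<in> carrier MG"
      using sub unfolding N'_def by blast
    have "(x \<triangleleft>\<^bsub>MG\<^esub> u) k \<triangleleft>\<^bsub>M\<^esub> \<sigma> k j = \<zero>\<^bsub>M\<^esub>" if k: "k \<in> carrier G" and j: "j \<in> J" for k j
    proof -
      have "(x \<triangleleft>\<^bsub>MG\<^esub> u) k \<in> {y \<in> carrier M. y \<triangleleft>\<^bsub>M\<^esub> \<sigma> k j = \<zero>\<^bsub>M\<^esub>}"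
      proof (rule ract_MG_mem[OF xM u])
        fix i h assume "i \<in> supp M x" "h \<in> supp R u" and kih: "i \<otimes>\<^bsub>G\<^esub> h = k"
        then have ih: "i \<in> carrier G" "h \<in> carrier G"
          using supp_MG[OF xM] supp_S[OF u] by auto
        \<comment> \<open>Closure needs \<open>J\<close> to be a core: being \<sigma>-stable and an
          ideal, it absorbs the factor that arises when j is moved past a term of u.\<close>
        have "u h \<otimes>\<^bsub>R\<^esub> \<sigma> h j \<in> J"
          using \<sigma>_core[OF I ih(2)] j ideal.I_l_closed[OF J] S_closed[OF u] unfolding J_def by blast
        then have "x i \<triangleleft>\<^bsub>M\<^esub> \<sigma> i (u h) \<triangleleft>\<^bsub>M\<^esub> \<sigma> i (\<sigma> h j) = \<zero>\<^bsub>M\<^esub>"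
          using x ih unfolding N'_def
          by (simp add: ract_\<sigma>_mult MG_closed[OF xM] S_closed[OF u] closed Jc[OF j])
        then show "x i \<triangleleft>\<^bsub>M\<^esub> \<sigma> i (u h) \<triangleleft>\<^bsub>M\<^esub> c i h \<in> {y \<in> carrier M. y \<triangleleft>\<^bsub>M\<^esub> \<sigma> k j = \<zero>\<^bsub>M\<^esub>}"
          using ih Jc[OF j] unfolding kih[symmetric]
          by (simp add: twisted_ract_eq_zero_iff ract_closed MG_closed[OF xM] S_closed[OF u] closed)
      qed (use k Jc[OF j] in \<open>auto simp: zero_ract ract_add_left closed\<close>)
      then show ?thesis
        by simp
    qed
    then show "x \<triangleleft>\<^bsub>MG\<^esub> u \<in> N'"
      using x right_submodule_ract[OF N _ u] unfolding N'_def by blast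
  qed
  moreover have "n \<in> N'"
  proof -
    have "n k \<triangleleft>\<^bsub>M\<^esub> \<sigma> k j = \<zero>\<^bsub>M\<^esub>" if k: "k \<in> carrier G" and j: "j \<in> J" for k j
    proof (cases "k \<in> supp M n")
      case True
      \<comment> \<open>A core is contained in its ideal, so j kills n g; goodness passes this on to
        the other coefficients of n.\<close>
      have "n g \<triangleleft>\<^bsub>M\<^esub> \<sigma> g j = \<zero>\<^bsub>M\<^esub>"
        using cyclic_ann_le[OF ng gG] j core_le unfolding J_def by blast
      then show ?thesis
        using n(2) True g Jc[OF j] unfolding good_def by blast
    next
      case False
      then show ?thesis
        using k Jc[OF j] by (simp add: supp_def zero_ract closed)
    qed
    then show ?thesis
      using n unfolding N'_def by blast
  qed
  moreover have "ann S (MG\<lparr>carrier := N'\<rparr>) = ideal_extension R G J"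
  proof
    show "ideal_extension R G J \<subseteq> ann S (MG\<lparr>carrier := N'\<rparr>)"
    proof
      fix u assume u: "u \<in> ideal_extension R G J"
      then have uS: "u \<in> carrier S"
        by (simp add: ideal_extension_def carrier_S)
      have "x \<triangleleft>\<^bsub>MG\<^esub> u = \<zero>\<^bsub>MG\<^esub>" if x: "x \<in> N'" for x
      proof
        fix k
        have xM: "x \<in> carrier MG"
          using x sub unfolding N'_def by blast
        show "(x \<triangleleft>\<^bsub>MG\<^esub> u) k = \<zero>\<^bsub>MG\<^esub> k"
          using ract_MG_eq_zero[OF xM uS, of k] x u supp_MG[OF xM] supp_S[OF uS]
          unfolding zero_MG N'_def ideal_extension_def by blast
      qed
      then show "u \<in> ann S (MG\<lparr>carrier := N'\<rparr>)"
        using uS by (simp add: ann_def)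
    qed
    show "ann S (MG\<lparr>carrier := N'\<rparr>) \<subseteq> ideal_extension R G J"
    proof
      fix u assume u: "u \<in> ann S (MG\<lparr>carrier := N'\<rparr>)"
      then have uS: "u \<in> carrier S"
        by (simp add: ann_def)
      \<comment> \<open>The test elements are the products of n with monomials. Varying s runs
        through the cyclic submodule generated by n g, and varying h turns its annihilator into the
        core.\<close>
      have "n g \<triangleleft>\<^bsub>M\<^esub> \<sigma> g s \<triangleleft>\<^bsub>M\<^esub> \<sigma> g (\<sigma> h (u k)) = \<zero>\<^bsub>M\<^esub>"
        if s: "s \<in> carrier R" and h: "h \<in> carrier G" for s h k
      proof -
        let ?z = "n \<triangleleft>\<^bsub>MG\<^esub> single s h"
        have z: "?z \<in> N'"
          using right_submodule_ract[OF \<open>right_submodule N' S MG\<close> \<open>n \<in> N'\<close> single_S[OF s h]] .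
        then have "?z \<triangleleft>\<^bsub>MG\<^esub> u = \<zero>\<^bsub>MG\<^esub>"
          using u by (simp add: ann_def)
        then have "?z (g \<otimes>\<^bsub>G\<^esub> h) \<triangleleft>\<^bsub>M\<^esub> \<sigma> (g \<otimes>\<^bsub>G\<^esub> h) (u k) = \<zero>\<^bsub>M\<^esub>"
          using good_ract_eq_zero[OF ract_MG_closed[OF nM single_S[OF s h]]
              good_single_ract[OF nM n(2) s h] uS] gG h by (simp add: closed)
        then show ?thesis
          unfolding single_ract[OF nM s gG h]
          using gG h s by (simp add: twisted_ract_eq_zero_iff ng ract_closed closed S_closed[OF uS])
      qed
      then have "\<sigma> h (u k) \<in> ?I" if "h \<in> carrier G" for h k
        using that unfolding cyclic_ann_def by (simp add: closed S_closed[OF uS])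
      then show "u \<in> ideal_extension R G J"
        using uS S_closed[OF uS] unfolding ideal_extension_def J_def core_def carrier_S by simp
    qed
  qed
  moreover have "N' \<subseteq> N"
    unfolding N'_def by blast
  ultimately show ?thesis
    unfolding J_def by blast
qed

text \<open>Every nonzero submodule \<open>K\<close> of \<open>N\<close> contains a good n and with
  it the submodule \<open>N'\<close> from \<open>good_submodule\<close>. The annihilator of
  \<open>K\<close> lies between those of \<open>N\<close> and \<open>N'\<close>, so it is enough to
  know the latter.\<close>

lemma prime_submodule_iff:
  assumes N: "right_submodule N S MG" and nz: "N \<noteq> {\<zero>\<^bsub>MG\<^esub>}"
  shows "prime_module S (MG\<lparr>carrier := N\<rparr>) \<longleftrightarrow>
    (\<forall>n\<in>N. good n \<longrightarrow> (\<forall>g\<in>supp M n.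
      ideal_extension R G (core R G \<sigma> (cyclic_ann R \<sigma> M (n g) g)) = ann S (MG\<lparr>carrier := N\<rparr>)))"
    (is "?P \<longleftrightarrow> ?Q")
proof
  assume ?P
  show ?Q
  proof (intro ballI impI)
    fix n g assume n: "n \<in> N" "good n" and g: "g \<in> supp M n"
    obtain N' where "N' \<subseteq> N" "right_submodule N' S MG" "n \<in> N'"
      "ann S (MG\<lparr>carrier := N'\<rparr>) = ideal_extension R G (core R G \<sigma> (cyclic_ann R \<sigma> M (n g) g))"
      using good_submodule[OF N n g] by blast
    moreover have "n \<noteq> \<zero>\<^bsub>MG\<^esub>"
      using g supp_empty_iff by blast
    ultimately show "ideal_extension R G (core R G \<sigma> (cyclic_ann R \<sigma> M (n g) g)) = ann S (MG\<lparr>carrier := N\<rparr>)"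
      using \<open>?P\<close> unfolding prime_module_restrict_iff[OF abelian_group_MG N] by blast
  qed
next
  assume ?Q
  show ?P
    unfolding prime_module_restrict_iff[OF abelian_group_MG N]
  proof (intro conjI nz allI impI)
    fix K assume KN: "K \<subseteq> N" and "right_submodule K S MG \<and> K \<noteq> {\<zero>\<^bsub>MG\<^esub>}"
    then have K: "right_submodule K S MG" "K \<noteq> {\<zero>\<^bsub>MG\<^esub>}"
      by blast+
    obtain n where n: "n \<in> K" "n \<noteq> \<zero>\<^bsub>MG\<^esub>" "good n"
      using exists_good[OF K] by blast
    then obtain g where g: "g \<in> supp M n"
      using supp_empty_iff by blast
    obtain N' where "N' \<subseteq> K"
      "ann S (MG\<lparr>carrier := N'\<rparr>) = ideal_extension R G (core R G \<sigma> (cyclic_ann R \<sigma> M (n g) g))"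
      using good_submodule[OF K(1) n(1,3) g] by blast
    then have "ann S (MG\<lparr>carrier := N'\<rparr>) = ann S (MG\<lparr>carrier := N\<rparr>)"
      using \<open>?Q\<close> n g KN by blast
    then show "ann S (MG\<lparr>carrier := K\<rparr>) = ann S (MG\<lparr>carrier := N\<rparr>)"
      using ann_restrict_antimono[OF \<open>N' \<subseteq> K\<close>, of S MG] ann_restrict_antimono[OF KN, of S MG] by blast
  qed
qed

section \<open>S-primeness as a condition on cores in \<open>R\<close>\<close>

lemma mono_MG:
  assumes "m \<in> carrier M" "h \<in> carrier G"
  shows "(\<lambda>k. if k = h then m else \<zero>\<^bsub>M\<^esub>) \<in> carrier MG"
  using assms by (auto simp: carrier_MG formal_sums_def supp_def intro: finite_subset[of _ "{h}"])

lemma mono_ract: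
  assumes m: "m \<in> carrier M" and h: "h \<in> carrier G" and u: "u \<in> carrier S" and k: "k \<in> carrier G"
  shows "((\<lambda>k. if k = h then m else \<zero>\<^bsub>M\<^esub>) \<triangleleft>\<^bsub>MG\<^esub> u) (h \<otimes>\<^bsub>G\<^esub> k) = m \<triangleleft>\<^bsub>M\<^esub> \<sigma> h (u k) \<triangleleft>\<^bsub>M\<^esub> c h k"
proof -
  have "((\<lambda>k. if k = h then m else \<zero>\<^bsub>M\<^esub>) \<triangleleft>\<^bsub>MG\<^esub> u) (h \<otimes>\<^bsub>G\<^esub> k) =
      (if h = h then m else \<zero>\<^bsub>M\<^esub>) \<triangleleft>\<^bsub>M\<^esub> \<sigma> h (u k) \<triangleleft>\<^bsub>M\<^esub> c h k"
  proof (rule ract_MG_unique[OF mono_MG[OF m h] u h k])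
    fix g' h'
    assume *: "g' \<in> supp M (\<lambda>k. if k = h then m else \<zero>\<^bsub>M\<^esub>)" "h' \<in> supp R u"
      "g' \<otimes>\<^bsub>G\<^esub> h' = h \<otimes>\<^bsub>G\<^esub> k" "(g', h') \<noteq> (h, k)"
    have "g' = h"
      using *(1) by (auto simp: supp_def split: if_splits)
    then show "(if g' = h then m else \<zero>\<^bsub>M\<^esub>) \<triangleleft>\<^bsub>M\<^esub> \<sigma> g' (u h') = \<zero>\<^bsub>M\<^esub>"
      using left_cancel[of h h' k] * supp_S[OF u] h k by blast
  qed
  then show ?thesis
    by simp
qed

text \<open>Monomials with coefficient m in degree h suffice as test elements: left cancellation
  keeps their products with u free of sums, so each \<sigma> h (u k) must kill m.\<close>

lemma ann_MG: "ann S MG = ideal_extension R G (core R G \<sigma> (ann R M))"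
proof
  show "ideal_extension R G (core R G \<sigma> (ann R M)) \<subseteq> ann S MG"
  proof
    fix u assume u: "u \<in> ideal_extension R G (core R G \<sigma> (ann R M))"
    then have uS: "u \<in> carrier S"
      by (simp add: ideal_extension_def carrier_S)
    have "x \<triangleleft>\<^bsub>MG\<^esub> u = \<zero>\<^bsub>MG\<^esub>" if x: "x \<in> carrier MG" for x
    proof
      fix k
      show "(x \<triangleleft>\<^bsub>MG\<^esub> u) k = \<zero>\<^bsub>MG\<^esub> k"
        unfolding zero_MG
      proof (rule ract_MG_eq_zero[OF x uS])
        fix g h assume "g \<in> supp M x" "h \<in> supp R u"
        then have gh: "g \<in> carrier G" "h \<in> carrier G"
          using supp_MG[OF x] supp_S[OF uS] by auto
        then have "\<sigma> g (u h) \<in> ann R M"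
          using u unfolding ideal_extension_def core_def by blast
        then show "x g \<triangleleft>\<^bsub>M\<^esub> \<sigma> g (u h) = \<zero>\<^bsub>M\<^esub>"
          using MG_closed[OF x] by (simp add: ann_def)
      qed
    qed
    then show "u \<in> ann S MG"
      using uS by (simp add: ann_def)
  qed
  show "ann S MG \<subseteq> ideal_extension R G (core R G \<sigma> (ann R M))"
  proof
    fix u assume u: "u \<in> ann S MG"
    then have uS: "u \<in> carrier S"
      by (simp add: ann_def)
    have "m \<triangleleft>\<^bsub>M\<^esub> \<sigma> h (u k) = \<zero>\<^bsub>M\<^esub>" if m: "m \<in> carrier M" and h: "h \<in> carrier G" and k: "k \<in> carrier G" for m h k
    proof -
      have "m \<triangleleft>\<^bsub>M\<^esub> \<sigma> h (u k) \<triangleleft>\<^bsub>M\<^esub> c h k = \<zero>\<^bsub>M\<^esub>"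
        unfolding mono_ract[OF m h uS k, symmetric]
        using u mono_MG[OF m h] by (simp add: ann_def zero_MG)
      then show ?thesis
        using m h k by (simp add: ract_Units_eq_zero_iff c_unit ract_closed closed S_closed[OF uS])
    qed
    then show "u \<in> ideal_extension R G (core R G \<sigma> (ann R M))"
      using uS S_closed[OF uS]
      unfolding ideal_extension_def core_def ann_def carrier_S by (simp add: closed)
  qed
qed

text \<open>Monomials are trivially good, so \<open>prime_submodule_iff\<close> yields the condition
  for all nonzero m and all degrees h. Conversely this condition covers every coefficient of every
  good element. From here on S-primeness is a statement about ideals of \<open>R\<close>
  alone.\<close>

lemma S_prime_iff:
  "S_prime R G \<sigma> c M \<longleftrightarrow> carrier M \<noteq> {\<zero>\<^bsub>M\<^esub>} \<and>
    (\<forall>m\<in>carrier M. \<forall>h\<in>carrier G. m \<noteq> \<zero>\<^bsub>M\<^esub> \<longrightarrow>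
      core R G \<sigma> (cyclic_ann R \<sigma> M m h) = core R G \<sigma> (ann R M))"
    (is "_ \<longleftrightarrow> ?nz \<and> ?Q")
proof -
  have sub: "right_submodule (carrier MG) S MG"
  proof -
    interpret MG: abelian_group MG by (rule abelian_group_MG)
    show ?thesis
      by (rule right_submoduleI[OF abelian_group_MG order_refl MG.zero_closed MG.a_closed
            MG.a_inv_closed ract_MG_closed])
  qed
  have MG_nz: "carrier MG \<noteq> {\<zero>\<^bsub>MG\<^esub>}" if M_nz: ?nz
  proof -
    obtain m where m: "m \<in> carrier M" "m \<noteq> \<zero>\<^bsub>M\<^esub>"
      using M_nz M.zero_closed by blast
    have "(\<lambda>k. if k = \<one>\<^bsub>G\<^esub> then m else \<zero>\<^bsub>M\<^esub>) \<noteq> \<zero>\<^bsub>MG\<^esub>"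
      using m(2) fun_cong[of _ "\<zero>\<^bsub>MG\<^esub>" "\<one>\<^bsub>G\<^esub>"] unfolding zero_MG by metis
    then show ?thesis
      using mono_MG[OF m(1) G.one_closed] by (metis singletonD)
  qed
  have ?nz if "carrier MG \<noteq> {\<zero>\<^bsub>MG\<^esub>}"
  proof
    assume zero: "carrier M = {\<zero>\<^bsub>M\<^esub>}"
    have "x = \<zero>\<^bsub>MG\<^esub>" if "x \<in> carrier MG" for x
      using MG_closed[OF that] zero unfolding zero_MG by auto
    then show False
      using that right_submodule_zero[OF sub] by blast
  qed
  then have nz: "S_prime R G \<sigma> c M \<Longrightarrow> ?nz"
    unfolding S_prime_def prime_module_def by blast
  have "prime_module S MG \<longleftrightarrow> ?Q" if ?nz
  proof -
    have inj: "ideal_extension R G (core R G \<sigma> (cyclic_ann R \<sigma> M m h)) = ann S MG \<longleftrightarrow>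
        core R G \<sigma> (cyclic_ann R \<sigma> M m h) = core R G \<sigma> (ann R M)"
      if "m \<in> carrier M" "h \<in> carrier G" for m h
      unfolding ann_MG using that
      by (intro ideal_extension_inject ideal_core ideal_cyclic_ann ideal_ann)
    have "prime_module S MG \<longleftrightarrow> (\<forall>n\<in>carrier MG. good n \<longrightarrow> (\<forall>g\<in>supp M n.
        ideal_extension R G (core R G \<sigma> (cyclic_ann R \<sigma> M (n g) g)) = ann S MG))"
      using prime_submodule_iff[OF sub MG_nz[OF that]] by simp
    also have "\<dots> \<longleftrightarrow> (\<forall>n\<in>carrier MG. good n \<longrightarrow> (\<forall>g\<in>supp M n.
        core R G \<sigma> (cyclic_ann R \<sigma> M (n g) g) = core R G \<sigma> (ann R M)))"
    proof -
      have "ideal_extension R G (core R G \<sigma> (cyclic_ann R \<sigma> M (n g) g)) = ann S MG \<longleftrightarrow>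
          core R G \<sigma> (cyclic_ann R \<sigma> M (n g) g) = core R G \<sigma> (ann R M)"
        if "n \<in> carrier MG" "g \<in> supp M n" for n g
        using inj[OF MG_closed[OF that(1)] subsetD[OF supp_MG[OF that(1)] that(2)]] .
      then show ?thesis
        by (simp cong: ball_cong)
    qed
    also have "\<dots> \<longleftrightarrow> ?Q"
    proof
      assume L: "\<forall>n\<in>carrier MG. good n \<longrightarrow> (\<forall>g\<in>supp M n.
        core R G \<sigma> (cyclic_ann R \<sigma> M (n g) g) = core R G \<sigma> (ann R M))"
      show ?Q
      proof (intro ballI impI)
        fix m h assume m: "m \<in> carrier M" "m \<noteq> \<zero>\<^bsub>M\<^esub>" and h: "h \<in> carrier G"
        let ?n = "\<lambda>k. if k = h then m else \<zero>\<^bsub>M\<^esub>"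
        have "supp M ?n = {h}"
          using m by (auto simp: supp_def)
        moreover from this have "good ?n"
          by (simp add: good_def)
        ultimately show "core R G \<sigma> (cyclic_ann R \<sigma> M m h) = core R G \<sigma> (ann R M)"
          using bspec[OF L mono_MG[OF m(1) h]] by simp
      qed
    next
      assume ?Q
      then have "core R G \<sigma> (cyclic_ann R \<sigma> M (n g) g) = core R G \<sigma> (ann R M)"
        if "n \<in> carrier MG" "g \<in> supp M n" for n g
        using MG_closed[OF that(1), of g] subsetD[OF supp_MG[OF that(1)] that(2)] that(2)
        by (simp add: supp_def)
      then show "\<forall>n\<in>carrier MG. good n \<longrightarrow> (\<forall>g\<in>supp M n.
          core R G \<sigma> (cyclic_ann R \<sigma> M (n g) g) = core R G \<sigma> (ann R M))"
        by blast
    qed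
    finally show ?thesis .
  qed
  then show ?thesis
    using nz unfolding S_prime_def by blast
qed

end

section \<open>Associated primes of induced modules\<close>

text \<open>Without a maximal member, dependent choice would build a strictly increasing sequence of
  ideals.\<close>

lemma acc_ideals_maximal:
  assumes acc: "acc_ideals R" and "A \<noteq> {}" and ideals: "\<And>I. I \<in> A \<Longrightarrow> ideal I R"
  shows "\<exists>P\<in>A. \<forall>Q\<in>A. P \<subseteq> Q \<longrightarrow> Q = P"
proof (rule ccontr)
  assume "\<not> ?thesis"
  then have step: "\<exists>Q. Q \<in> A \<and> P \<subset> Q" if "P \<in> A" for P
    using that by blast
  have "\<exists>I. \<forall>n. I n \<in> A \<and> I n \<subset> I (Suc n)"
    by (rule dependent_nat_choice) (use \<open>A \<noteq> {}\<close> step in auto)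
  then obtain I :: "nat \<Rightarrow> 'a set" where I: "\<And>n. I n \<in> A" "\<And>n. I n \<subset> I (Suc n)"
    by blast
  then have "\<exists>N. \<forall>n\<ge>N. I n = I N"
    using acc[unfolded acc_ideals_def, rule_format, of I] ideals by blast
  then show False
    using I(2) le_Suc_eq by blast
qed

lemma right_submodule_twist:
  assumes "right_submodule L R M" "\<And>r. r \<in> carrier R \<Longrightarrow> \<phi> r \<in> carrier R"
  shows "right_submodule L R (twist M \<phi>)"
  using assms by (simp add: right_submodule_def twist_simps)

lemma right_submodule_untwist:
  assumes L: "right_submodule L R (twist M \<phi>)" and surj: "\<phi> ` carrier R = carrier R"
  shows "right_submodule L R M"
proof -
  have "x \<triangleleft>\<^bsub>M\<^esub> r \<in> L" if x: "x \<in> L" and r: "r \<in> carrier R" for x r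
  proof -
    obtain s where "s \<in> carrier R" "r = \<phi> s"
      using surj r by blast
    then show ?thesis
      using L x by (simp add: right_submodule_def twist_simps)
  qed
  then show ?thesis
    using L by (simp add: right_submodule_def twist_simps)
qed

lemma cyclic_ann_restrict: "cyclic_ann R \<sigma> (M\<lparr>carrier := L\<rparr>) m h = cyclic_ann R \<sigma> M m h"
  by (simp add: cyclic_ann_def)

section \<open>Ideals under equivalent endomorphisms, and cores of preimages\<close>

lemma (in crossed_up_system) equiv_up_to_inner_mem_iff:
  assumes "equiv_up_to_inner R \<sigma> g h" "ideal I R" "g \<in> carrier G" "h \<in> carrier G" "r \<in> carrier R"
  shows "\<sigma> g r \<in> I \<longleftrightarrow> \<sigma> h r \<in> I"
proof -
  obtain u where u: "u \<in> Units R" "\<sigma> g r = u \<otimes>\<^bsub>R\<^esub> \<sigma> h r \<otimes>\<^bsub>R\<^esub> inv\<^bsub>R\<^esub> u"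
    using assms(1,5) unfolding equiv_up_to_inner_def by blast
  have "\<sigma> g r \<otimes>\<^bsub>R\<^esub> u = u \<otimes>\<^bsub>R\<^esub> \<sigma> h r"
    using u R.Units_closed[OF u(1)] assms by (simp add: R.m_assoc closed)
  then show ?thesis
    using ideal_conj_mem_iff[OF assms(2) _ _ u(1)] assms by (simp add: closed)
qed

lemma (in crossed_up_system) core_le_core_vimage:
  assumes "ideal I R" "g \<in> carrier G"
  shows "core R G \<sigma> I \<subseteq> core R G \<sigma> {r \<in> carrier R. \<sigma> g r \<in> I}"
proof
  fix r assume r: "r \<in> core R G \<sigma> I"
  have "\<sigma> g (\<sigma> h r) \<in> I" if "h \<in> carrier G" for h
    using \<sigma>_core[OF assms(1) that r] assms(2) unfolding core_def by blast
  then show "r \<in> core R G \<sigma> {r \<in> carrier R. \<sigma> g r \<in> I}"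
    using r unfolding core_def by (simp add: closed)
qed

text \<open>This is the ring version of the fact that a surjective endomorphism of a Noetherian
  object is injective, applied to the endomorphism that \<sigma> g induces on \<open>R / I\<close>.
  The ideals \<open>J n\<close> pull back the kernels of its powers.\<close>

lemma (in crossed_up_system) mem_of_\<sigma>_mem:
  assumes acc: "acc_ideals R" and surj: "\<sigma> g ` carrier R = carrier R" and g: "g \<in> carrier G"
    and I: "ideal I R" and stable: "\<And>r. r \<in> I \<Longrightarrow> \<sigma> g r \<in> I"
    and r: "r \<in> carrier R" "\<sigma> g r \<in> I"
  shows "r \<in> I"
proof -
  define J where "J n = {r \<in> carrier R. (\<sigma> g ^^ n) r \<in> I}" for n
  have Suc_eq: "J (Suc n) = {r \<in> carrier R. \<sigma> g r \<in> J n}" for n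
    unfolding J_def by (auto simp: funpow_swap1 \<sigma>_closed[OF g])
  have "J 0 = I"
    unfolding J_def using ideal.Icarr[OF I] by auto
  then have "ideal (J n) R" for n
    by (induction n) (use I ideal_vimage[OF _ \<sigma>_hom[OF g]] Suc_eq in auto)
  moreover have "J n \<subseteq> J (Suc n)" for n
    unfolding J_def using stable by auto
  ultimately obtain N where N: "J n = J N" if "n \<ge> N" for n
    using acc[unfolded acc_ideals_def, rule_format, of J] by blast
  \<comment> \<open>Surjectivity writes r as the N-th iterate of \<sigma> g at some s. Then \<sigma>
    g r is the next iterate at s, and stationarity of the chain at N takes membership in
    \<open>I\<close> one step back, to r.\<close>
  have "\<exists>s\<in>carrier R. r = (\<sigma> g ^^ n) s" for n
  proof (induction n)
    case (Suc n)
    then obtain s where s: "s \<in> carrier R" "r = (\<sigma> g ^^ n) s"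
      by blast
    obtain t where "t \<in> carrier R" "s = \<sigma> g t"
      using surj s(1) by blast
    then show ?case
      using s(2) by (auto simp: funpow_swap1)
  qed (use r in auto)
  then obtain s where s: "s \<in> carrier R" "r = (\<sigma> g ^^ N) s"
    by blast
  then have "s \<in> J (Suc N)"
    using r(2) by (simp add: J_def)
  then have "s \<in> J N"
    using N[of "Suc N"] by simp
  then show ?thesis
    using s(2) by (simp add: J_def)
qed

text \<open>For the inclusion that is not formal, \<sigma> h r is written as \<sigma> g s. Both r
  and \<sigma> h r lie in the core of the preimage, and \<open>mem_of_\<sigma>_mem\<close> applied
  to this stable ideal puts s there as well. Hence s is in the preimage, that is, \<sigma> g s is in
  \<open>P\<close>.\<close>

lemma (in crossed_up_system) core_vimage_acc:
  assumes acc: "acc_ideals R" and surj: "\<sigma> g ` carrier R = carrier R" and g: "g \<in> carrier G"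
    and P: "ideal P R"
  shows "core R G \<sigma> {r \<in> carrier R. \<sigma> g r \<in> P} = core R G \<sigma> P"
proof
  let ?Q = "{r \<in> carrier R. \<sigma> g r \<in> P}"
  have Q: "ideal ?Q R"
    using ideal_vimage[OF P \<sigma>_hom[OF g]] .
  show "core R G \<sigma> ?Q \<subseteq> core R G \<sigma> P"
  proof
    fix r assume r: "r \<in> core R G \<sigma> ?Q"
    then have rR: "r \<in> carrier R"
      using core_subset by blast
    have "\<sigma> h r \<in> P" if h: "h \<in> carrier G" for h
    proof -
      obtain s where s: "s \<in> carrier R" "\<sigma> h r = \<sigma> g s"
        using surj \<sigma>_closed[OF h rR] by blast
      have "\<sigma> g s \<in> core R G \<sigma> ?Q"
        using \<sigma>_core[OF Q h r] s(2) by simp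
      then have "s \<in> core R G \<sigma> ?Q"
        using mem_of_\<sigma>_mem[OF acc surj g ideal_core[OF Q] \<sigma>_core[OF Q g]] s(1) by blast
      then show ?thesis
        using core_le s(2) by fastforce
    qed
    then show "r \<in> core R G \<sigma> P"
      using rR by (simp add: core_def)
  qed
qed (rule core_le_core_vimage[OF P g])

context crossed_module
begin

section \<open>S-primeness of submodules of \<open>M\<close> and of its twists\<close>

lemma crossed_module_restrict:
  "right_submodule L R M \<Longrightarrow> crossed_module R G \<sigma> c (M\<lparr>carrier := L\<rparr>)"
  by (rule crossed_module.intro[OF crossed_up_system_axioms right_module_restrict])

lemma crossed_module_twist:
  "g \<in> carrier G \<Longrightarrow> crossed_module R G \<sigma> c (twist M (\<sigma> g))"
  by (rule crossed_module.intro[OF crossed_up_system_axioms right_module_twist[OF \<sigma>_hom]])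

lemma S_prime_restrict_iff:
  assumes "right_submodule L R M"
  shows "S_prime R G \<sigma> c (M\<lparr>carrier := L\<rparr>) \<longleftrightarrow> L \<noteq> {\<zero>\<^bsub>M\<^esub>} \<and>
    (\<forall>m\<in>L. \<forall>h\<in>carrier G. m \<noteq> \<zero>\<^bsub>M\<^esub> \<longrightarrow>
      core R G \<sigma> (cyclic_ann R \<sigma> M m h) = core R G \<sigma> (ann R (M\<lparr>carrier := L\<rparr>)))"
  using crossed_module.S_prime_iff[OF crossed_module_restrict[OF assms]]
  by (simp add: cyclic_ann_restrict)

lemma S_prime_twist_iff:
  assumes "g \<in> carrier G" "right_submodule L R (twist M (\<sigma> g))"
  shows "S_prime R G \<sigma> c (twist M (\<sigma> g)\<lparr>carrier := L\<rparr>) \<longleftrightarrow> L \<noteq> {\<zero>\<^bsub>M\<^esub>} \<and>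
    (\<forall>m\<in>L. \<forall>h\<in>carrier G. m \<noteq> \<zero>\<^bsub>M\<^esub> \<longrightarrow>
      core R G \<sigma> (cyclic_ann R \<sigma> (twist M (\<sigma> g)) m h) =
      core R G \<sigma> (ann R (twist M (\<sigma> g)\<lparr>carrier := L\<rparr>)))"
  using crossed_module.S_prime_restrict_iff[OF crossed_module_twist[OF assms(1)] assms(2)]
  by (simp add: twist_simps)

lemma ann_twist_restrict:
  assumes "g \<in> carrier G"
  shows "ann R (twist M (\<sigma> g)\<lparr>carrier := L\<rparr>) = {r \<in> carrier R. \<sigma> g r \<in> ann R (M\<lparr>carrier := L\<rparr>)}"
  using assms by (auto simp: ann_def twist_simps \<sigma>_closed)

text \<open>Degree h over the twist corresponds to degree gh over \<open>M\<close>, with the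
  coefficient corrected by the unit \<open>c g h\<close>.\<close>

lemma cyclic_ann_twist:
  assumes m: "m \<in> carrier M" and g: "g \<in> carrier G" and h: "h \<in> carrier G"
  shows "cyclic_ann R \<sigma> (twist M (\<sigma> g)) m h = cyclic_ann R \<sigma> M (m \<triangleleft>\<^bsub>M\<^esub> c g h) (g \<otimes>\<^bsub>G\<^esub> h)"
proof -
  have "m \<triangleleft>\<^bsub>M\<^esub> \<sigma> g (\<sigma> h s) \<triangleleft>\<^bsub>M\<^esub> \<sigma> g (\<sigma> h r) = \<zero>\<^bsub>M\<^esub> \<longleftrightarrow>
      m \<triangleleft>\<^bsub>M\<^esub> c g h \<triangleleft>\<^bsub>M\<^esub> \<sigma> (g \<otimes>\<^bsub>G\<^esub> h) s \<triangleleft>\<^bsub>M\<^esub> \<sigma> (g \<otimes>\<^bsub>G\<^esub> h) r = \<zero>\<^bsub>M\<^esub>"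
    if "s \<in> carrier R" "r \<in> carrier R" for s r
    using that m g h
    by (simp add: ract_\<sigma>_mult twisted_ract_eq_zero_iff ract_closed closed flip: \<sigma>_mult)
  then show ?thesis
    unfolding cyclic_ann_def by (auto simp: twist_simps)
qed

lemma core_ann_le_cyclic:
  assumes "m \<in> carrier M" "h \<in> carrier G"
  shows "core R G \<sigma> (ann R M) \<subseteq> core R G \<sigma> (cyclic_ann R \<sigma> M m h)"
proof -
  have "core R G \<sigma> {r \<in> carrier R. \<sigma> h r \<in> ann R M} \<subseteq> core R G \<sigma> (cyclic_ann R \<sigma> M m h)"
    by (rule core_mono) (use assms in \<open>auto simp: cyclic_ann_def ann_def ract_closed closed\<close>)
  then show ?thesis
    using core_le_core_vimage[OF ideal_ann assms(2)] by blast
qed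

text \<open>
  The annihilator of a submodule of \<open>twist M (\<sigma> g)\<close> already involves \<open>\<sigma> g\<close>, so the preimage
  under \<open>\<sigma> g\<close> in the description of the associated primes twists a second time; by this lemma
  that changes nothing after passing to the core.
\<close>

lemma S_prime_core_vimage:
  assumes M: "S_prime R G \<sigma> c M" and g: "g \<in> carrier G"
  shows "core R G \<sigma> {r \<in> carrier R. \<sigma> g r \<in> ann R M} = core R G \<sigma> (ann R M)"
proof
  obtain m where m: "m \<in> carrier M" "m \<noteq> \<zero>\<^bsub>M\<^esub>"
    using M M.zero_closed unfolding S_prime_iff by blast
  \<comment> \<open>If \<sigma> g r kills \<open>M\<close>, it kills the cyclic submodule of m in
    the twist. S-primeness, tested in degree h = g, identifies the core of that larger annihilator
    with the core of the annihilator of \<open>M\<close>.\<close>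
  have "{r \<in> carrier R. \<sigma> g r \<in> ann R M} \<subseteq> cyclic_ann R \<sigma> M m g"
    using m g by (auto simp: cyclic_ann_def ann_def ract_closed closed)
  then show "core R G \<sigma> {r \<in> carrier R. \<sigma> g r \<in> ann R M} \<subseteq> core R G \<sigma> (ann R M)"
    using core_mono M m g unfolding S_prime_iff by blast
qed (rule core_le_core_vimage[OF ideal_ann g])

text \<open>\<open>L\<close> is the cyclic submodule generated by one coefficient n g of a good
  element n. Each test of S-primeness for \<open>L\<close> is realised inside \<open>N\<close> by a
  product of n with a monomial, to which primeness of \<open>N\<close> applies.\<close>

lemma prime_submodule_S_prime:
  assumes N: "right_submodule N S MG" and prime: "prime_module S (MG\<lparr>carrier := N\<rparr>)"
  shows "\<exists>g\<in>carrier G. \<exists>L. right_submodule L R (twist M (\<sigma> g)) \<and>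
    S_prime R G \<sigma> c (twist M (\<sigma> g)\<lparr>carrier := L\<rparr>) \<and>
    ann S (MG\<lparr>carrier := N\<rparr>) = ideal_extension R G (core R G \<sigma> (ann R (twist M (\<sigma> g)\<lparr>carrier := L\<rparr>)))"
proof -
  have nz: "N \<noteq> {\<zero>\<^bsub>MG\<^esub>}"
    using prime unfolding prime_module_def by simp
  have sub: "N \<subseteq> carrier MG"
    using right_submodule_subset[OF N] .
  have prime': "ideal_extension R G (core R G \<sigma> (cyclic_ann R \<sigma> M (n g) g)) = ann S (MG\<lparr>carrier := N\<rparr>)"
    if "n \<in> N" "good n" "g \<in> supp M n" for n g
    using prime that unfolding prime_submodule_iff[OF N nz] by blast
  obtain n where n: "n \<in> N" "n \<noteq> \<zero>\<^bsub>MG\<^esub>" "good n"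
    using exists_good[OF N nz] by blast
  then obtain g where g: "g \<in> supp M n"
    using supp_empty_iff by blast
  have nM: "n \<in> carrier MG"
    using n sub by blast
  have gG: "g \<in> carrier G"
    using g supp_MG[OF nM] by blast
  define m where "m = n g"
  have m: "m \<in> carrier M" "m \<noteq> \<zero>\<^bsub>M\<^esub>"
    using MG_closed[OF nM] g unfolding m_def by (auto simp: supp_def)
  let ?L = "(\<lambda>s. m \<triangleleft>\<^bsub>M\<^esub> \<sigma> g s) ` carrier R"
  have L: "right_submodule ?L R (twist M (\<sigma> g))"
    by (rule right_submodule_cyclic[OF m(1) gG])
  have "S_prime R G \<sigma> c (twist M (\<sigma> g)\<lparr>carrier := ?L\<rparr>)"
    unfolding S_prime_twist_iff[OF gG L]
  proof (intro conjI ballI impI)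
    have "m \<in> ?L"
      by (rule image_eqI[of _ _ "\<one>\<^bsub>R\<^esub>"]) (simp_all add: \<sigma>_ring_one gG ract_one m)
    then show "?L \<noteq> {\<zero>\<^bsub>M\<^esub>}"
      using m(2) by (metis singletonD)
  next
    fix l h assume "l \<in> ?L" and h: "h \<in> carrier G" and l0: "l \<noteq> \<zero>\<^bsub>M\<^esub>"
    then obtain s where s: "s \<in> carrier R" and l: "l = m \<triangleleft>\<^bsub>M\<^esub> \<sigma> g s"
      by blast
    have lM: "l \<in> carrier M"
      unfolding l using m gG s by (simp add: ract_closed closed)
    \<comment> \<open>In degree gh this good element has coefficient l times \<open>c g h\<close>.
      That is exactly the element whose cyclic annihilator in degree gh equals that of l in degree h
      over the twist.\<close>
    let ?z = "n \<triangleleft>\<^bsub>MG\<^esub> single s h"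
    have z: "?z \<in> N"
      using right_submodule_ract[OF N n(1) single_S[OF s h]] .
    have zgh: "?z (g \<otimes>\<^bsub>G\<^esub> h) = l \<triangleleft>\<^bsub>M\<^esub> c g h"
      unfolding single_ract[OF nM s gG h] l m_def ..
    have "g \<otimes>\<^bsub>G\<^esub> h \<in> supp M ?z"
      unfolding supp_def mem_Collect_eq zgh
      using l0 ract_Units_eq_zero_iff[OF lM c_unit[OF gG h]] by blast
    then have "ideal_extension R G (core R G \<sigma> (cyclic_ann R \<sigma> M (l \<triangleleft>\<^bsub>M\<^esub> c g h) (g \<otimes>\<^bsub>G\<^esub> h))) =
        ann S (MG\<lparr>carrier := N\<rparr>)"
      using prime'[OF z good_single_ract[OF nM n(3) s h]] unfolding zgh[symmetric] by blast
    also have "\<dots> = ideal_extension R G (core R G \<sigma> (cyclic_ann R \<sigma> M m g))"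
      unfolding m_def using prime'[OF n(1,3) g] ..
    finally have "core R G \<sigma> (cyclic_ann R \<sigma> M (l \<triangleleft>\<^bsub>M\<^esub> c g h) (g \<otimes>\<^bsub>G\<^esub> h)) =
        core R G \<sigma> (cyclic_ann R \<sigma> M m g)"
      using ideal_extension_inject[OF ideal_core[OF ideal_cyclic_ann] ideal_core[OF ideal_cyclic_ann]]
        m gG lM h by (simp add: ract_closed closed)
    then show "core R G \<sigma> (cyclic_ann R \<sigma> (twist M (\<sigma> g)) l h) =
        core R G \<sigma> (ann R (twist M (\<sigma> g)\<lparr>carrier := ?L\<rparr>))"
      unfolding ann_cyclic cyclic_ann_twist[OF lM gG h] .
  qed
  moreover have "ann S (MG\<lparr>carrier := N\<rparr>) =
      ideal_extension R G (core R G \<sigma> (ann R (twist M (\<sigma> g)\<lparr>carrier := ?L\<rparr>)))"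
    unfolding ann_cyclic m_def using prime'[OF n(1,3) g] ..
  ultimately show ?thesis
    using gG L by blast
qed

text \<open>
  The submodule \<open>N\<close> is the image of \<open>L * G\<close> under the embedding \<open>l h \<mapsto> (l (c g h)) (g h)\<close>.
\<close>

lemma S_prime_prime_submodule:
  assumes g: "g \<in> carrier G" and L: "right_submodule L R (twist M (\<sigma> g))"
    and prime: "S_prime R G \<sigma> c (twist M (\<sigma> g)\<lparr>carrier := L\<rparr>)"
  shows "\<exists>N. right_submodule N S MG \<and> prime_module S (MG\<lparr>carrier := N\<rparr>) \<and>
    ann S (MG\<lparr>carrier := N\<rparr>) = ideal_extension R G (core R G \<sigma> (ann R (twist M (\<sigma> g)\<lparr>carrier := L\<rparr>)))"
proof -
  let ?J = "ann R (twist M (\<sigma> g)\<lparr>carrier := L\<rparr>)"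
  have LM: "l \<in> carrier M" if "l \<in> L" for l
    using right_submodule_subset[OF L] that by (auto simp: twist_simps)
  have L0: "\<zero>\<^bsub>M\<^esub> \<in> L"
    using right_submodule_zero[OF L] by (simp add: twist_simps)
  have L_add: "l \<oplus>\<^bsub>M\<^esub> l' \<in> L" if "l \<in> L" "l' \<in> L" for l l'
    using right_submodule_add[OF L that] by (simp add: twist_simps)
  have L_ract: "l \<triangleleft>\<^bsub>M\<^esub> \<sigma> g r \<in> L" if "l \<in> L" "r \<in> carrier R" for l r
    using right_submodule_ract[OF L that] by (simp add: twist_simps)
  have L_inv: "\<ominus>\<^bsub>M\<^esub> l \<in> L" if "l \<in> L" for l
    using right_submodule_a_inv[OF L that] by (simp add: a_inv_def m_inv_def twist_def)
  \<comment> \<open>\<open>B k\<close> is the degree k component of \<open>N\<close>. Left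
    cancellation makes h unique for k = gh, so the component is a copy of \<open>L\<close> there; in
    degrees outside gG it is zero.\<close>
  define B where "B k = insert \<zero>\<^bsub>M\<^esub> {l \<triangleleft>\<^bsub>M\<^esub> c g h | l h. l \<in> L \<and> h \<in> carrier G \<and> k = g \<otimes>\<^bsub>G\<^esub> h}" for k
  have B_eq: "B (g \<otimes>\<^bsub>G\<^esub> h) = (\<lambda>l. l \<triangleleft>\<^bsub>M\<^esub> c g h) ` L" if h: "h \<in> carrier G" for h
  proof -
    have "h' = h" if "h' \<in> carrier G" "g \<otimes>\<^bsub>G\<^esub> h = g \<otimes>\<^bsub>G\<^esub> h'" for h'
      using left_cancel[OF g that(1) h] that(2) by simp
    moreover have "\<zero>\<^bsub>M\<^esub> \<in> (\<lambda>l. l \<triangleleft>\<^bsub>M\<^esub> c g h) ` L"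
      using zero_ract[OF c_closed[OF g h]] L0 by force
    ultimately show ?thesis
      unfolding B_def using h by blast
  qed
  have B_cases: "(\<exists>h\<in>carrier G. k = g \<otimes>\<^bsub>G\<^esub> h) \<or> B k = {\<zero>\<^bsub>M\<^esub>}" for k
    unfolding B_def by blast
  have B_sub: "B k \<subseteq> carrier M" for k
    unfolding B_def using LM g by (auto simp: ract_closed closed)
  have B_add: "x \<oplus>\<^bsub>M\<^esub> y \<in> B k" if xy: "x \<in> B k" "y \<in> B k" for x y k
    using B_cases[of k]
  proof
    assume "\<exists>h\<in>carrier G. k = g \<otimes>\<^bsub>G\<^esub> h"
    then obtain h where h: "h \<in> carrier G" "k = g \<otimes>\<^bsub>G\<^esub> h"
      by blast
    then obtain l l' where "l \<in> L" "l' \<in> L" "x = l \<triangleleft>\<^bsub>M\<^esub> c g h" "y = l' \<triangleleft>\<^bsub>M\<^esub> c g h"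
      using xy B_eq[OF h(1)] by blast
    then have "x \<oplus>\<^bsub>M\<^esub> y = (l \<oplus>\<^bsub>M\<^esub> l') \<triangleleft>\<^bsub>M\<^esub> c g h" "l \<oplus>\<^bsub>M\<^esub> l' \<in> L"
      using LM L_add g h by (simp_all add: ract_add_left closed)
    then show ?thesis
      using B_eq[OF h(1)] h(2) by blast
  qed (use xy in auto)
  have B_inv: "\<ominus>\<^bsub>M\<^esub> x \<in> B k" if xy: "x \<in> B k" for x k
    using B_cases[of k]
  proof
    assume "\<exists>h\<in>carrier G. k = g \<otimes>\<^bsub>G\<^esub> h"
    then obtain h where h: "h \<in> carrier G" "k = g \<otimes>\<^bsub>G\<^esub> h"
      by blast
    then obtain l where "l \<in> L" "x = l \<triangleleft>\<^bsub>M\<^esub> c g h"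
      using xy B_eq[OF h(1)] by blast
    then have "\<ominus>\<^bsub>M\<^esub> x = (\<ominus>\<^bsub>M\<^esub> l) \<triangleleft>\<^bsub>M\<^esub> c g h" "\<ominus>\<^bsub>M\<^esub> l \<in> L"
      using LM L_inv g h by (simp_all add: ract_a_inv_left closed)
    then show ?thesis
      using B_eq[OF h(1)] h(2) by blast
  qed (use xy in auto)
  define N where "N = {x \<in> carrier MG. \<forall>k. x k \<in> B k}"
  have N_supp: "\<exists>h\<in>carrier G. \<exists>l\<in>L. k = g \<otimes>\<^bsub>G\<^esub> h \<and> x k = l \<triangleleft>\<^bsub>M\<^esub> c g h"
    if "x \<in> N" "k \<in> supp M x" for x k
  proof -
    have "x k \<in> B k" "x k \<noteq> \<zero>\<^bsub>M\<^esub>"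
      using that unfolding N_def supp_def by blast+
    then show ?thesis
      unfolding B_def by blast
  qed
  interpret MG: abelian_group MG by (rule abelian_group_MG)
  have N: "right_submodule N S MG"
  proof (rule right_submoduleI[OF abelian_group_MG])
    show "N \<subseteq> carrier MG"
      unfolding N_def by blast
    show "\<zero>\<^bsub>MG\<^esub> \<in> N"
      using MG.zero_closed unfolding N_def zero_MG B_def by blast
  next
    fix x y assume "x \<in> N" "y \<in> N"
    then show "x \<oplus>\<^bsub>MG\<^esub> y \<in> N"
      using MG.a_closed[of x y] B_add unfolding N_def add_MG by blast
  next
    fix x assume x: "x \<in> N"
    then have "x \<in> carrier MG"
      unfolding N_def by blast
    then show "\<ominus>\<^bsub>MG\<^esub> x \<in> N"
      using x MG.a_inv_closed[of x] B_inv a_inv_MG[of x] unfolding N_def by simp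
  next
    fix x u assume x: "x \<in> N" and u: "u \<in> carrier S"
    then have xM: "x \<in> carrier MG"
      unfolding N_def by blast
    have "(x \<triangleleft>\<^bsub>MG\<^esub> u) k \<in> B k" for k
    proof (rule ract_MG_mem[OF xM u _ B_add B_sub])
      show "\<zero>\<^bsub>M\<^esub> \<in> B k"
        unfolding B_def by blast
      fix i j assume i: "i \<in> supp M x" and j: "j \<in> supp R u" and k: "i \<otimes>\<^bsub>G\<^esub> j = k"
      obtain h l where h: "h \<in> carrier G" "i = g \<otimes>\<^bsub>G\<^esub> h" and l: "l \<in> L" "x i = l \<triangleleft>\<^bsub>M\<^esub> c g h"
        using N_supp[OF x i] by blast
      have jG: "j \<in> carrier G"
        using j supp_S[OF u] by blast
      note uj = S_closed[OF u, of j]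
      have "x i \<triangleleft>\<^bsub>M\<^esub> \<sigma> i (u j) \<triangleleft>\<^bsub>M\<^esub> c i j = l \<triangleleft>\<^bsub>M\<^esub> \<sigma> g (\<sigma> h (u j)) \<triangleleft>\<^bsub>M\<^esub> c g h \<triangleleft>\<^bsub>M\<^esub> c (g \<otimes>\<^bsub>G\<^esub> h) j"
        unfolding l(2) unfolding h(2) using twisted_ract[OF LM[OF l(1)] g h(1) uj] by simp
      \<comment> \<open>The cocycle identity rewrites \<open>c g h\<close> times
        \<open>c (gh) j\<close> so that one factor is again an image under \<sigma> g, which
        preserves \<open>L\<close>, and the other is the unit of the component in degree
        g(hj).\<close>
      also have "\<dots> = l \<triangleleft>\<^bsub>M\<^esub> \<sigma> g (\<sigma> h (u j)) \<triangleleft>\<^bsub>M\<^esub> (\<sigma> g (c h j) \<otimes>\<^bsub>R\<^esub> c g (h \<otimes>\<^bsub>G\<^esub> j))"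
        using LM[OF l(1)] g h(1) jG uj by (simp add: ract_assoc[of "_ \<triangleleft>\<^bsub>M\<^esub> _"] ract_closed closed cocycle)
      also have "\<dots> = l \<triangleleft>\<^bsub>M\<^esub> \<sigma> g (\<sigma> h (u j)) \<triangleleft>\<^bsub>M\<^esub> \<sigma> g (c h j) \<triangleleft>\<^bsub>M\<^esub> c g (h \<otimes>\<^bsub>G\<^esub> j)"
        using LM[OF l(1)] g h(1) jG uj by (simp add: ract_assoc[of "_ \<triangleleft>\<^bsub>M\<^esub> _"] ract_closed closed)
      also have "\<dots> \<in> B (g \<otimes>\<^bsub>G\<^esub> (h \<otimes>\<^bsub>G\<^esub> j))"
        unfolding B_eq[OF G.m_closed[OF h(1) jG]]
        using L_ract[OF L_ract[OF l(1)]] h(1) jG uj by (simp add: closed)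
      also have "g \<otimes>\<^bsub>G\<^esub> (h \<otimes>\<^bsub>G\<^esub> j) = k"
        using k h g jG by (simp add: G.m_assoc)
      finally show "x i \<triangleleft>\<^bsub>M\<^esub> \<sigma> i (u j) \<triangleleft>\<^bsub>M\<^esub> c i j \<in> B k" .
    qed
    then show "x \<triangleleft>\<^bsub>MG\<^esub> u \<in> N"
      using ract_MG_closed[OF xM u] unfolding N_def by blast
  qed
  have L_core: "core R G \<sigma> (cyclic_ann R \<sigma> (twist M (\<sigma> g)) l h) = core R G \<sigma> ?J"
    if "l \<in> L" "l \<noteq> \<zero>\<^bsub>M\<^esub>" "h \<in> carrier G" for l h
    using prime that unfolding S_prime_twist_iff[OF g L] by blast
  have N_nz: "N \<noteq> {\<zero>\<^bsub>MG\<^esub>}"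
  proof -
    obtain l where l: "l \<in> L" "l \<noteq> \<zero>\<^bsub>M\<^esub>"
      using prime L0 unfolding S_prime_twist_iff[OF g L] by blast
    \<comment> \<open>The identity degree of \<open>L * G\<close> corresponds to degree g of
      \<open>N\<close>, where the correcting unit \<open>c g 1\<close> is one.\<close>
    let ?x = "\<lambda>k. if k = g then l else \<zero>\<^bsub>M\<^esub>"
    have "l \<in> B g"
      using B_eq[OF G.one_closed] l(1) LM[OF l(1)] g by (force simp: c_one_right ract_one)
    moreover have "\<zero>\<^bsub>M\<^esub> \<in> B k" for k
      unfolding B_def by blast
    ultimately have "?x \<in> N"
      unfolding N_def using mono_MG[OF LM[OF l(1)] g] by simp
    moreover have "?x \<noteq> \<zero>\<^bsub>MG\<^esub>"
      using l(2) fun_cong[of ?x "\<zero>\<^bsub>MG\<^esub>" g] unfolding zero_MG by auto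
    ultimately show ?thesis
      by (metis singletonD)
  qed
  \<comment> \<open>The core does not depend on the element or the degree, and goodness of n is not
    assumed. One good element then bounds the annihilator of \<open>N\<close> from above.\<close>
  have core_eq: "core R G \<sigma> (cyclic_ann R \<sigma> M (n k) k) = core R G \<sigma> ?J"
    if n: "n \<in> N" and k: "k \<in> supp M n" for n k
  proof -
    obtain h l where h: "h \<in> carrier G" "k = g \<otimes>\<^bsub>G\<^esub> h" and l: "l \<in> L" "n k = l \<triangleleft>\<^bsub>M\<^esub> c g h"
      using N_supp[OF n k] by blast
    have "l \<noteq> \<zero>\<^bsub>M\<^esub>"
      using k l(2) zero_ract[OF c_closed[OF g h(1)]] unfolding supp_def by force
    then show ?thesis
      using L_core[OF l(1) _ h(1)] unfolding l(2) unfolding h(2) cyclic_ann_twist[OF LM[OF l(1)] g h(1)] by blast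
  qed
  have ann_N: "ann S (MG\<lparr>carrier := N\<rparr>) = ideal_extension R G (core R G \<sigma> ?J)"
  proof
    obtain n where n: "n \<in> N" "n \<noteq> \<zero>\<^bsub>MG\<^esub>" "good n"
      using exists_good[OF N N_nz] by blast
    then obtain k where k: "k \<in> supp M n"
      using supp_empty_iff by blast
    obtain N' where "N' \<subseteq> N" "ann S (MG\<lparr>carrier := N'\<rparr>) = ideal_extension R G (core R G \<sigma> ?J)"
      using good_submodule[OF N n(1,3) k] unfolding core_eq[OF n(1) k] by blast
    then show "ann S (MG\<lparr>carrier := N\<rparr>) \<subseteq> ideal_extension R G (core R G \<sigma> ?J)"
      using ann_restrict_antimono[of N' N S MG] by blast
    show "ideal_extension R G (core R G \<sigma> ?J) \<subseteq> ann S (MG\<lparr>carrier := N\<rparr>)"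
    proof
      fix u assume u: "u \<in> ideal_extension R G (core R G \<sigma> ?J)"
      then have uS: "u \<in> carrier S"
        by (simp add: ideal_extension_def carrier_S)
      have "x \<triangleleft>\<^bsub>MG\<^esub> u = \<zero>\<^bsub>MG\<^esub>" if x: "x \<in> N" for x
      proof
        fix k
        have xM: "x \<in> carrier MG"
          using x unfolding N_def by blast
        show "(x \<triangleleft>\<^bsub>MG\<^esub> u) k = \<zero>\<^bsub>MG\<^esub> k"
          unfolding zero_MG
        proof (rule ract_MG_eq_zero[OF xM uS])
          fix i j assume i: "i \<in> supp M x" and j: "j \<in> supp R u"
          obtain h l where h: "h \<in> carrier G" "i = g \<otimes>\<^bsub>G\<^esub> h" and l: "l \<in> L" "x i = l \<triangleleft>\<^bsub>M\<^esub> c g h"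
            using N_supp[OF x i] by blast
          have "j \<in> carrier G"
            using j supp_S[OF uS] by blast
          then have "\<sigma> h (u j) \<in> ?J"
            using u h(1) unfolding ideal_extension_def core_def by blast
          then have "l \<triangleleft>\<^bsub>M\<^esub> \<sigma> g (\<sigma> h (u j)) = \<zero>\<^bsub>M\<^esub>"
            using l(1) by (simp add: ann_def twist_simps)
          then show "x i \<triangleleft>\<^bsub>M\<^esub> \<sigma> i (u j) = \<zero>\<^bsub>M\<^esub>"
            unfolding l(2) unfolding h(2) twisted_ract_eq_zero_iff[OF LM[OF l(1)] g h(1) S_closed[OF uS]] .
        qed
      qed
      then show "u \<in> ann S (MG\<lparr>carrier := N\<rparr>)"
        using uS by (simp add: ann_def)
    qed
  qed
  have "prime_module S (MG\<lparr>carrier := N\<rparr>)"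
    unfolding prime_submodule_iff[OF N N_nz] ann_N using core_eq by simp
  then show ?thesis
    using N ann_N by blast
qed

section \<open>The descriptions of the associated primes of the induced module\<close>

lemma Ass_MG:
  "Ass S MG = {ideal_extension R G (core R G \<sigma> (ann R (twist M (\<sigma> g)\<lparr>carrier := L\<rparr>))) | g L.
    g \<in> carrier G \<and> right_submodule L R (twist M (\<sigma> g)) \<and>
    S_prime R G \<sigma> c (twist M (\<sigma> g)\<lparr>carrier := L\<rparr>)}" (is "_ = ?A")
proof
  show "Ass S MG \<subseteq> ?A"
  proof
    fix I assume "I \<in> Ass S MG"
    then obtain N where N: "right_submodule N S MG" "prime_module S (MG\<lparr>carrier := N\<rparr>)"
      and I: "I = ann S (MG\<lparr>carrier := N\<rparr>)"
      unfolding Ass_def by blast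
    show "I \<in> ?A"
      using prime_submodule_S_prime[OF N] unfolding I by blast
  qed
  show "?A \<subseteq> Ass S MG"
  proof
    fix I assume "I \<in> ?A"
    then obtain g L where g: "g \<in> carrier G" and L: "right_submodule L R (twist M (\<sigma> g))"
      "S_prime R G \<sigma> c (twist M (\<sigma> g)\<lparr>carrier := L\<rparr>)"
      and I: "I = ideal_extension R G (core R G \<sigma> (ann R (twist M (\<sigma> g)\<lparr>carrier := L\<rparr>)))"
      by blast
    show "I \<in> Ass S MG"
      using S_prime_prime_submodule[OF g L] unfolding I Ass_def by blast
  qed
qed

lemma Ass_MG_vimage:
  "Ass S MG = {ideal_extension R G (core R G \<sigma> {r \<in> carrier R. \<sigma> g r \<in> J}) | g J.
    g \<in> carrier G \<and> J \<in> S_prime_annihilators R G \<sigma> c (twist M (\<sigma> g))}"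
proof -
  have "core R G \<sigma> {r \<in> carrier R. \<sigma> g r \<in> ann R (twist M (\<sigma> g)\<lparr>carrier := L\<rparr>)} =
      core R G \<sigma> (ann R (twist M (\<sigma> g)\<lparr>carrier := L\<rparr>))"
    if g: "g \<in> carrier G" and L: "right_submodule L R (twist M (\<sigma> g))"
      and prime: "S_prime R G \<sigma> c (twist M (\<sigma> g)\<lparr>carrier := L\<rparr>)" for g L
    by (rule crossed_module.S_prime_core_vimage[OF
          crossed_module.crossed_module_restrict[OF crossed_module_twist[OF g] L] prime g])
  note eq = this
  show ?thesis
    unfolding Ass_MG S_prime_annihilators_def
  proof (intro equalityI subsetI)
    fix I assume "I \<in> {ideal_extension R G (core R G \<sigma> (ann R (twist M (\<sigma> g)\<lparr>carrier := L\<rparr>))) | g L.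
      g \<in> carrier G \<and> right_submodule L R (twist M (\<sigma> g)) \<and>
      S_prime R G \<sigma> c (twist M (\<sigma> g)\<lparr>carrier := L\<rparr>)}"
    then obtain g L where gL: "g \<in> carrier G" "right_submodule L R (twist M (\<sigma> g))"
      "S_prime R G \<sigma> c (twist M (\<sigma> g)\<lparr>carrier := L\<rparr>)"
      and I: "I = ideal_extension R G (core R G \<sigma> (ann R (twist M (\<sigma> g)\<lparr>carrier := L\<rparr>)))"
      by blast
    show "I \<in> {ideal_extension R G (core R G \<sigma> {r \<in> carrier R. \<sigma> g r \<in> J}) | g J.
      g \<in> carrier G \<and> J \<in> {ann R (twist M (\<sigma> g)\<lparr>carrier := L\<rparr>) | L.
        right_submodule L R (twist M (\<sigma> g)) \<and> S_prime R G \<sigma> c (twist M (\<sigma> g)\<lparr>carrier := L\<rparr>)}}"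
      unfolding I eq[OF gL, symmetric] using gL by blast
  next
    fix I assume "I \<in> {ideal_extension R G (core R G \<sigma> {r \<in> carrier R. \<sigma> g r \<in> J}) | g J.
      g \<in> carrier G \<and> J \<in> {ann R (twist M (\<sigma> g)\<lparr>carrier := L\<rparr>) | L.
        right_submodule L R (twist M (\<sigma> g)) \<and> S_prime R G \<sigma> c (twist M (\<sigma> g)\<lparr>carrier := L\<rparr>)}}"
    then obtain g L where gL: "g \<in> carrier G" "right_submodule L R (twist M (\<sigma> g))"
      "S_prime R G \<sigma> c (twist M (\<sigma> g)\<lparr>carrier := L\<rparr>)"
      and I: "I = ideal_extension R G (core R G \<sigma> {r \<in> carrier R. \<sigma> g r \<in> ann R (twist M (\<sigma> g)\<lparr>carrier := L\<rparr>)})"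
      by blast
    show "I \<in> {ideal_extension R G (core R G \<sigma> (ann R (twist M (\<sigma> g)\<lparr>carrier := L\<rparr>))) | g L.
      g \<in> carrier G \<and> right_submodule L R (twist M (\<sigma> g)) \<and>
      S_prime R G \<sigma> c (twist M (\<sigma> g)\<lparr>carrier := L\<rparr>)}"
      unfolding I eq[OF gL] using gL by blast
  qed
qed

text \<open>This is the case where g is the identity. There \<sigma> is the identity only on
  \<open>carrier R\<close>, so the twist and \<open>M\<close> are compared through their
  annihilators rather than as equal records.\<close>

lemma S_prime_mem_Ass:
  assumes L: "right_submodule L R M" and prime: "S_prime R G \<sigma> c (M\<lparr>carrier := L\<rparr>)"
  shows "ideal_extension R G (core R G \<sigma> (ann R (M\<lparr>carrier := L\<rparr>))) \<in> Ass S MG"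
proof -
  have tw: "right_submodule L R (twist M (\<sigma> \<one>\<^bsub>G\<^esub>))"
    by (rule right_submodule_twist[OF L]) (simp add: closed)
  have ann: "ann R (twist M (\<sigma> \<one>\<^bsub>G\<^esub>)\<lparr>carrier := L\<rparr>) = ann R (M\<lparr>carrier := L\<rparr>)"
    unfolding ann_twist_restrict[OF G.one_closed] by (auto simp: \<sigma>_one ann_def)
  have "cyclic_ann R \<sigma> (twist M (\<sigma> \<one>\<^bsub>G\<^esub>)) m h = cyclic_ann R \<sigma> M m h"
    if "m \<in> L" "h \<in> carrier G" for m h
    unfolding cyclic_ann_def using that by (auto simp: twist_simps \<sigma>_one closed)
  then have "S_prime R G \<sigma> c (twist M (\<sigma> \<one>\<^bsub>G\<^esub>)\<lparr>carrier := L\<rparr>)"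
    using prime unfolding S_prime_twist_iff[OF G.one_closed tw] S_prime_restrict_iff[OF L] ann by simp
  then show ?thesis
    unfolding Ass_MG ann[symmetric] using tw G.one_closed by blast
qed

text \<open>With \<sigma> g surjective, the cyclic submodule generated by m in the twist is the same
  set as in \<open>M\<close>; only the acting element r remains twisted.\<close>

lemma cyclic_ann_surj:
  assumes m: "m \<in> carrier M" and g: "g \<in> carrier G" and surj: "\<sigma> g ` carrier R = carrier R"
  shows "cyclic_ann R \<sigma> M m g = {r \<in> carrier R. \<sigma> g r \<in> cyclic_ann R \<sigma> M m \<one>\<^bsub>G\<^esub>}"
proof -
  have "(\<forall>s\<in>\<sigma> g ` carrier R. P s) \<longleftrightarrow> (\<forall>s\<in>carrier R. P (\<sigma> g s))" for P
    by blast
  then have "(\<forall>s\<in>carrier R. m \<triangleleft>\<^bsub>M\<^esub> s \<triangleleft>\<^bsub>M\<^esub> \<sigma> g r = \<zero>\<^bsub>M\<^esub>) \<longleftrightarrow>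
      (\<forall>s\<in>carrier R. m \<triangleleft>\<^bsub>M\<^esub> \<sigma> g s \<triangleleft>\<^bsub>M\<^esub> \<sigma> g r = \<zero>\<^bsub>M\<^esub>)" for r
    unfolding surj .
  then show ?thesis
    unfolding cyclic_ann_def using g by (simp add: \<sigma>_one closed cong: conj_cong)
qed

lemma cyclic_ann_twist_surj:
  assumes m: "m \<in> carrier M" and g: "g \<in> carrier G" and h: "h \<in> carrier G"
    and surj: "\<sigma> g ` carrier R = carrier R" "\<sigma> h ` carrier R = carrier R"
  shows "cyclic_ann R \<sigma> (twist M (\<sigma> g)) m h =
    {r \<in> carrier R. \<sigma> g (\<sigma> h r) \<in> cyclic_ann R \<sigma> M m \<one>\<^bsub>G\<^esub>}"
proof -
  have "(\<forall>s\<in>\<sigma> g ` \<sigma> h ` carrier R. P s) \<longleftrightarrow> (\<forall>s\<in>carrier R. P (\<sigma> g (\<sigma> h s)))" for P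
    by blast
  then have "(\<forall>s\<in>carrier R. m \<triangleleft>\<^bsub>M\<^esub> s \<triangleleft>\<^bsub>M\<^esub> \<sigma> g (\<sigma> h r) = \<zero>\<^bsub>M\<^esub>) \<longleftrightarrow>
      (\<forall>s\<in>carrier R. m \<triangleleft>\<^bsub>M\<^esub> \<sigma> g (\<sigma> h s) \<triangleleft>\<^bsub>M\<^esub> \<sigma> g (\<sigma> h r) = \<zero>\<^bsub>M\<^esub>)" for r
    unfolding surj .
  then show ?thesis
    unfolding cyclic_ann_def using g h by (simp add: twist_simps \<sigma>_one closed cong: conj_cong)
qed

text \<open>An element r of the core to be bounded is pulled back along \<sigma> g to s.
  Reversibility then moves \<sigma> g to the outermost position, where S-primeness over the twist
  applies to s, and afterwards moves it back next to s.\<close>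

lemma S_prime_untwist:
  assumes surj: "pointwise_surjective R G \<sigma>" and rev: "reversible_up_to_conjugation R G \<sigma>"
    and g: "g \<in> carrier G" and tw: "right_submodule L R (twist M (\<sigma> g))"
    and prime: "S_prime R G \<sigma> c (twist M (\<sigma> g)\<lparr>carrier := L\<rparr>)"
  shows "S_prime R G \<sigma> c (M\<lparr>carrier := L\<rparr>)"
proof -
  have srj: "\<sigma> h ` carrier R = carrier R" if "h \<in> carrier G" for h
    using surj that unfolding pointwise_surjective_def by blast
  have L: "right_submodule L R M"
    by (rule right_submodule_untwist[OF tw srj[OF g]])
  let ?A = "ann R (M\<lparr>carrier := L\<rparr>)"
  have A: "ideal ?A R"
    by (rule ideal_ann_restrict[OF L])
  show ?thesis
    unfolding S_prime_restrict_iff[OF L]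
  proof (intro conjI ballI impI)
    show "L \<noteq> {\<zero>\<^bsub>M\<^esub>}"
      using prime unfolding S_prime_twist_iff[OF g tw] by blast
    fix m k assume m: "m \<in> L" and k: "k \<in> carrier G" and m0: "m \<noteq> \<zero>\<^bsub>M\<^esub>"
    have mM: "m \<in> carrier M"
      using m right_submodule_subset[OF L] by blast
    define I where "I = cyclic_ann R \<sigma> M m \<one>\<^bsub>G\<^esub>"
    have I: "ideal I R"
      unfolding I_def by (rule ideal_cyclic_ann[OF mM G.one_closed])
    let ?I' = "{r \<in> carrier R. \<sigma> k r \<in> I}"
    have I': "ideal ?I' R"
      by (rule ideal_vimage[OF I \<sigma>_hom[OF k]])
    \<comment> \<open>k' is the degree in which S-primeness over the twist will be tested: it
      replaces k once \<sigma> g has passed to its left.\<close>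
    obtain k' where k': "k' \<in> carrier G" "equiv_up_to_inner R \<sigma> (k \<otimes>\<^bsub>G\<^esub> g) (g \<otimes>\<^bsub>G\<^esub> k')"
      using rev g k unfolding reversible_up_to_conjugation_def by blast
    have "core R G \<sigma> (cyclic_ann R \<sigma> M m k) \<subseteq> core R G \<sigma> ?A"
    proof
      fix r assume r: "r \<in> core R G \<sigma> (cyclic_ann R \<sigma> M m k)"
      then have rR: "r \<in> carrier R"
        using core_subset by blast
      have rI: "\<sigma> h r \<in> ?I'" if "h \<in> carrier G" for h
        using r that unfolding cyclic_ann_surj[OF mM k srj[OF k]] core_def I_def by blast
      obtain s where s: "s \<in> carrier R" "r = \<sigma> g s"
        using srj[OF g] rR by blast
      \<comment> \<open>Two exchanges occur: gh is replaced by h1 g to use the hypothesis on r =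
        \<sigma> g s in degree h1, and kg by gk' to bring \<sigma> g to the outside.\<close>
      have "\<sigma> g (\<sigma> k' (\<sigma> h s)) \<in> I" if h: "h \<in> carrier G" for h
      proof -
        obtain h1 where h1: "h1 \<in> carrier G" "equiv_up_to_inner R \<sigma> (g \<otimes>\<^bsub>G\<^esub> h) (h1 \<otimes>\<^bsub>G\<^esub> g)"
          using rev g h unfolding reversible_up_to_conjugation_def by blast
        have "\<sigma> (h1 \<otimes>\<^bsub>G\<^esub> g) s \<in> ?I'"
          using rI[OF h1(1)] \<sigma>_comp_mem_iff[OF I' h1(1) g s(1)] unfolding s(2) by blast
        then have "\<sigma> (g \<otimes>\<^bsub>G\<^esub> h) s \<in> ?I'"
          using equiv_up_to_inner_mem_iff[OF h1(2) I'] h1(1) g h s(1) by blast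
        then have "\<sigma> k (\<sigma> g (\<sigma> h s)) \<in> I"
          using \<sigma>_comp_mem_iff[OF I' g h s(1)] by blast
        then have "\<sigma> (k \<otimes>\<^bsub>G\<^esub> g) (\<sigma> h s) \<in> I"
          using \<sigma>_comp_mem_iff[OF I k g \<sigma>_closed[OF h s(1)]] by blast
        then have "\<sigma> (g \<otimes>\<^bsub>G\<^esub> k') (\<sigma> h s) \<in> I"
          using equiv_up_to_inner_mem_iff[OF k'(2) I _ _ \<sigma>_closed[OF h s(1)]] k k' g by blast
        then show ?thesis
          using \<sigma>_comp_mem_iff[OF I g k'(1) \<sigma>_closed[OF h s(1)]] by blast
      qed
      then have "s \<in> core R G \<sigma> (cyclic_ann R \<sigma> (twist M (\<sigma> g)) m k')"
        unfolding cyclic_ann_twist_surj[OF mM g k'(1) srj[OF g] srj[OF k'(1)]] core_def I_def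
        using s(1) by (simp add: closed)
      then have "s \<in> core R G \<sigma> (ann R (twist M (\<sigma> g)\<lparr>carrier := L\<rparr>))"
        using prime m m0 k'(1) unfolding S_prime_twist_iff[OF g tw] by blast
      then have sA: "\<sigma> g (\<sigma> h s) \<in> ?A" if "h \<in> carrier G" for h
        using that unfolding ann_twist_restrict[OF g] core_def by blast
      \<comment> \<open>The last exchange, of hg for g h2, turns information on \<sigma> g (\<sigma>
        h2 s) into information on \<sigma> h (\<sigma> g s) = \<sigma> h r.\<close>
      have "\<sigma> h r \<in> ?A" if h: "h \<in> carrier G" for h
      proof -
        obtain h2 where h2: "h2 \<in> carrier G" "equiv_up_to_inner R \<sigma> (h \<otimes>\<^bsub>G\<^esub> g) (g \<otimes>\<^bsub>G\<^esub> h2)"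
          using rev g h unfolding reversible_up_to_conjugation_def by blast
        have "\<sigma> (g \<otimes>\<^bsub>G\<^esub> h2) s \<in> ?A"
          using sA[OF h2(1)] \<sigma>_comp_mem_iff[OF A g h2(1) s(1)] by blast
        then have "\<sigma> (h \<otimes>\<^bsub>G\<^esub> g) s \<in> ?A"
          using equiv_up_to_inner_mem_iff[OF h2(2) A] h2(1) g h s(1) by blast
        then show ?thesis
          using \<sigma>_comp_mem_iff[OF A h g s(1)] unfolding s(2) by blast
      qed
      then show "r \<in> core R G \<sigma> ?A"
        using rR by (simp add: core_def)
    qed
    moreover have "core R G \<sigma> ?A \<subseteq> core R G \<sigma> (cyclic_ann R \<sigma> M m k)"
      using crossed_module.core_ann_le_cyclic[OF crossed_module_restrict[OF L], of m k] m k
      by (simp add: cyclic_ann_restrict)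
    ultimately show "core R G \<sigma> (cyclic_ann R \<sigma> M m k) = core R G \<sigma> ?A"
      by blast
  qed
qed

lemma Ass_MG_reversible:
  assumes surj: "pointwise_surjective R G \<sigma>" and rev: "reversible_up_to_conjugation R G \<sigma>"
  shows "Ass S MG = {ideal_extension R G (core R G \<sigma> J) | J. J \<in> S_prime_annihilators R G \<sigma> c M}"
proof
  show "{ideal_extension R G (core R G \<sigma> J) | J. J \<in> S_prime_annihilators R G \<sigma> c M} \<subseteq> Ass S MG"
    unfolding S_prime_annihilators_def using S_prime_mem_Ass by blast
  show "Ass S MG \<subseteq> {ideal_extension R G (core R G \<sigma> J) | J. J \<in> S_prime_annihilators R G \<sigma> c M}"
  proof
    fix I assume "I \<in> Ass S MG"
    then obtain g L where g: "g \<in> carrier G" and tw: "right_submodule L R (twist M (\<sigma> g))"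
      and prime: "S_prime R G \<sigma> c (twist M (\<sigma> g)\<lparr>carrier := L\<rparr>)"
      and I: "I = ideal_extension R G (core R G \<sigma> (ann R (twist M (\<sigma> g)\<lparr>carrier := L\<rparr>)))"
      unfolding Ass_MG by blast
    have srj: "\<sigma> g ` carrier R = carrier R"
      using surj g unfolding pointwise_surjective_def by blast
    have L: "right_submodule L R M"
      by (rule right_submodule_untwist[OF tw srj])
    have prime': "S_prime R G \<sigma> c (M\<lparr>carrier := L\<rparr>)"
      by (rule S_prime_untwist[OF surj rev g tw prime])
    have "I = ideal_extension R G (core R G \<sigma> (ann R (M\<lparr>carrier := L\<rparr>)))"
      unfolding I ann_twist_restrict[OF g]
        crossed_module.S_prime_core_vimage[OF crossed_module_restrict[OF L] prime' g] ..
    then show "I \<in> {ideal_extension R G (core R G \<sigma> J) | J. J \<in> S_prime_annihilators R G \<sigma> c M}"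
      unfolding S_prime_annihilators_def using L prime' by blast
  qed
qed

text \<open>The cyclic submodule generated by m in the identity degree is mR, a nonzero submodule of
  the prime module \<open>L\<close>.\<close>

lemma prime_cyclic_ann:
  assumes L: "right_submodule L R M" and prime: "prime_module R (M\<lparr>carrier := L\<rparr>)"
    and m: "m \<in> L" "m \<noteq> \<zero>\<^bsub>M\<^esub>"
  shows "cyclic_ann R \<sigma> M m \<one>\<^bsub>G\<^esub> = ann R (M\<lparr>carrier := L\<rparr>)"
proof -
  let ?K = "(\<lambda>s. m \<triangleleft>\<^bsub>M\<^esub> \<sigma> \<one>\<^bsub>G\<^esub> s) ` carrier R"
  have mM: "m \<in> carrier M"
    using m right_submodule_subset[OF L] by blast
  have surj: "\<sigma> \<one>\<^bsub>G\<^esub> ` carrier R = carrier R"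
    by (simp add: \<sigma>_one)
  have K: "right_submodule ?K R M"
    by (rule right_submodule_untwist[OF right_submodule_cyclic[OF mM G.one_closed] surj])
  have "?K \<subseteq> L"
    using right_submodule_ract[OF L m(1)] by (auto simp: \<sigma>_one)
  moreover have "m \<in> ?K"
    by (rule image_eqI[of _ _ "\<one>\<^bsub>R\<^esub>"]) (simp_all add: \<sigma>_one ract_one mM)
  then have "?K \<noteq> {\<zero>\<^bsub>M\<^esub>}"
    using m(2) by (metis singletonD)
  ultimately have "ann R (M\<lparr>carrier := ?K\<rparr>) = ann R (M\<lparr>carrier := L\<rparr>)"
    using prime K unfolding prime_module_restrict_iff[OF M.abelian_group_axioms L] by blast
  moreover have "ann R (M\<lparr>carrier := ?K\<rparr>) = ann R (twist M (\<sigma> \<one>\<^bsub>G\<^esub>)\<lparr>carrier := ?K\<rparr>)"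
    by (auto simp: ann_def twist_simps \<sigma>_one)
  ultimately show ?thesis
    using ann_cyclic by metis
qed

lemma Ass_MG_acc:
  assumes acc: "acc_ideals R" and surj: "pointwise_surjective R G \<sigma>"
  shows "Ass S MG = {ideal_extension R G (core R G \<sigma> P) | P. P \<in> Ass R M}"
proof
  have srj: "\<sigma> h ` carrier R = carrier R" if "h \<in> carrier G" for h
    using surj that unfolding pointwise_surjective_def by blast
  show "{ideal_extension R G (core R G \<sigma> P) | P. P \<in> Ass R M} \<subseteq> Ass S MG"
  proof -
    have "ideal_extension R G (core R G \<sigma> (ann R (M\<lparr>carrier := L\<rparr>))) \<in> Ass S MG"
      if L: "right_submodule L R M" and prime: "prime_module R (M\<lparr>carrier := L\<rparr>)" for L
    proof (rule S_prime_mem_Ass[OF L])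
      \<comment> \<open>Primeness of \<open>L\<close> and surjectivity make the cyclic annihilator
        in degree h the preimage under \<sigma> h of the annihilator of \<open>L\<close>; the chain
        condition removes the preimage inside the core.\<close>
      have "core R G \<sigma> (cyclic_ann R \<sigma> M m h) = core R G \<sigma> (ann R (M\<lparr>carrier := L\<rparr>))"
        if m: "m \<in> L" "m \<noteq> \<zero>\<^bsub>M\<^esub>" and h: "h \<in> carrier G" for m h
      proof -
        have "m \<in> carrier M"
          using m right_submodule_subset[OF L] by blast
        then show ?thesis
          using cyclic_ann_surj[OF _ h srj[OF h], of m] prime_cyclic_ann[OF L prime m]
            core_vimage_acc[OF acc srj[OF h] h ideal_ann_restrict[OF L]] by simp
      qed
      moreover have "L \<noteq> {\<zero>\<^bsub>M\<^esub>}"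
        using prime unfolding prime_module_def by simp
      ultimately show "S_prime R G \<sigma> c (M\<lparr>carrier := L\<rparr>)"
        unfolding S_prime_restrict_iff[OF L] by blast
    qed
    then show ?thesis
      unfolding Ass_def[of R M] by blast
  qed
  show "Ass S MG \<subseteq> {ideal_extension R G (core R G \<sigma> P) | P. P \<in> Ass R M}"
  proof
    fix I assume "I \<in> Ass S MG"
    then obtain g L where g: "g \<in> carrier G" and tw: "right_submodule L R (twist M (\<sigma> g))"
      and prime: "S_prime R G \<sigma> c (twist M (\<sigma> g)\<lparr>carrier := L\<rparr>)"
      and I: "I = ideal_extension R G (core R G \<sigma> (ann R (twist M (\<sigma> g)\<lparr>carrier := L\<rparr>)))"
      unfolding Ass_MG by blast
    have L: "right_submodule L R M"
      by (rule right_submodule_untwist[OF tw srj[OF g]])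
    have L_nz: "L \<noteq> {\<zero>\<^bsub>M\<^esub>}"
      using prime unfolding S_prime_twist_iff[OF g tw] by blast
    \<comment> \<open>A nonzero submodule \<open>K\<close> of \<open>L\<close> whose annihilator is
      maximal in this family is prime, since annihilators only grow on passing to submodules of
      \<open>K\<close>.\<close>
    let ?A = "{ann R (M\<lparr>carrier := K\<rparr>) | K. K \<subseteq> L \<and> right_submodule K R M \<and> K \<noteq> {\<zero>\<^bsub>M\<^esub>}}"
    have "?A \<noteq> {}"
      using L L_nz by blast
    moreover have "ideal I R" if "I \<in> ?A" for I
      using that ideal_ann_restrict by blast
    ultimately obtain P where P: "P \<in> ?A" "\<forall>Q\<in>?A. P \<subseteq> Q \<longrightarrow> Q = P"
      using acc_ideals_maximal[OF acc, of ?A] by blast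
    then obtain K where K: "K \<subseteq> L" "right_submodule K R M" "K \<noteq> {\<zero>\<^bsub>M\<^esub>}" "P = ann R (M\<lparr>carrier := K\<rparr>)"
      by blast
    have prime_K: "prime_module R (M\<lparr>carrier := K\<rparr>)"
      unfolding prime_module_restrict_iff[OF M.abelian_group_axioms K(2)]
    proof (intro conjI K(3) allI impI)
      fix K' assume "K' \<subseteq> K" "right_submodule K' R M \<and> K' \<noteq> {\<zero>\<^bsub>M\<^esub>}"
      then show "ann R (M\<lparr>carrier := K'\<rparr>) = ann R (M\<lparr>carrier := K\<rparr>)"
        using P(2) K ann_restrict_antimono[of K' K R M] by blast
    qed
    obtain m where m: "m \<in> K" "m \<noteq> \<zero>\<^bsub>M\<^esub>"
      using right_submodule_zero[OF K(2)] K(3) by blast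
    have mM: "m \<in> carrier M"
      using m right_submodule_subset[OF K(2)] by blast
    have PR: "ideal P R"
      using ideal_ann_restrict[OF K(2)] K(4) by simp
    \<comment> \<open>S-primeness of \<open>L\<close> over the twist is tested on an element m of
      the prime submodule \<open>K\<close> in the identity degree. This replaces the annihilator of
      \<open>L\<close> by a preimage of \<open>P\<close>.\<close>
    have "core R G \<sigma> (ann R (twist M (\<sigma> g)\<lparr>carrier := L\<rparr>)) =
        core R G \<sigma> (cyclic_ann R \<sigma> (twist M (\<sigma> g)) m \<one>\<^bsub>G\<^esub>)"
      using prime m K(1) unfolding S_prime_twist_iff[OF g tw] by auto
    also have "cyclic_ann R \<sigma> (twist M (\<sigma> g)) m \<one>\<^bsub>G\<^esub> = {r \<in> carrier R. \<sigma> g (\<sigma> \<one>\<^bsub>G\<^esub> r) \<in> P}"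
      using cyclic_ann_twist_surj[OF mM g G.one_closed srj[OF g] srj[OF G.one_closed]]
      unfolding prime_cyclic_ann[OF K(2) prime_K m] K(4) .
    also have "\<dots> = {r \<in> carrier R. \<sigma> g r \<in> P}"
      using \<sigma>_one by auto
    also have "core R G \<sigma> \<dots> = core R G \<sigma> P"
      by (rule core_vimage_acc[OF acc srj[OF g] g PR])
    finally have "I = ideal_extension R G (core R G \<sigma> P)"
      unfolding I by simp
    moreover have "P \<in> Ass R M"
      unfolding Ass_def K(4) using K(2) prime_K by blast
    ultimately show "I \<in> {ideal_extension R G (core R G \<sigma> P) | P. P \<in> Ass R M}"
      by blast
  qed
qed

end

theorem proposition4p16:
  fixes R :: "('a, 'r) ring_scheme" and G :: "('g, 'k) monoid_scheme"
    and \<sigma> :: "'g \<Rightarrow> 'a \<Rightarrow> 'a" and c :: "'g \<Rightarrow> 'g \<Rightarrow> 'a"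
    and M :: "('a, 'b, 'm) right_module_scheme"
  assumes "unique_product_monoid G"
    and "crossed_system R G \<sigma> c"
    and "right_module R M"
  shows
    "Ass (crossed_product R G \<sigma> c) (induced_module R G \<sigma> c M) =
       {ideal_extension R G (core R G \<sigma> {r \<in> carrier R. \<sigma> g r \<in> J}) | g J.
          g \<in> carrier G \<and> J \<in> S_prime_annihilators R G \<sigma> c (twist M (\<sigma> g))} \<and>
     (pointwise_surjective R G \<sigma> \<and> reversible_up_to_conjugation R G \<sigma> \<longrightarrow>
       Ass (crossed_product R G \<sigma> c) (induced_module R G \<sigma> c M) =
         {ideal_extension R G (core R G \<sigma> J) | J. J \<in> S_prime_annihilators R G \<sigma> c M}) \<and>
     (acc_ideals R \<and> pointwise_surjective R G \<sigma> \<longrightarrow>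
       Ass (crossed_product R G \<sigma> c) (induced_module R G \<sigma> c M) =
         {ideal_extension R G (core R G \<sigma> P) | P. P \<in> Ass R M})"
proof -
  interpret crossed_module R G \<sigma> c M
    using assms by (intro crossed_module.intro crossed_up_system.intro)
  show ?thesis
    using Ass_MG_vimage Ass_MG_reversible Ass_MG_acc by blast
qed

end
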